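(* Let $\mathcal L:\sum_{i=1}^kc_ix_i=0$ be a homogeneous linear equation with $k\ge3$ and $c_1,\dots,c_k\in\mathbb Z\setminus\{0\}$, and assume there is $I\subseteq[k]$ with $|I|\ge3$ and $\sum_{i\in I}c_i=0$. Then for every $\varepsilon>0$ there exists $C=C(\varepsilon,\mathcal L)$ such that for every prime $p$ and every $\mathcal L$-solution-free set $A\subseteq\mathbb F_p$ with $|A|\ge\varepsilon p$, we have $\chi(\mathsf{Cay}(\mathbb F_p,A))\le C$.
   Context: A set $A\subseteq\mathbb F_p$ is $\mathcal L$-solution-free if there is no $(x_1,\dots,x_k)\in A^k$ with pairwise distinct entries and $\sum_ic_ix_i=0$ in $\mathbb F_p$. $\mathsf{Cay}(\mathbb F_p,A)$ is the Cayley digraph with arc $u\to v$ iff $v-u\in A$; $\chi$ is the chromatic number of its underlying undirected graph. *)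

theory Defs
  imports Complex_Main "HOL-Computational_Algebra.Primes"
begin

text \<open>F_p is modelled as the residues {0..<p} (integers), with arithmetic mod p.
  A linear equation sum_{i<k} c_i x_i = 0 is given by coefficients c :: nat => int on {0..<k}.\<close>

definition solution_free :: "nat \<Rightarrow> (nat \<Rightarrow> int) \<Rightarrow> int \<Rightarrow> int set \<Rightarrow> bool" where
  "solution_free k c p A \<longleftrightarrow>
     \<not> (\<exists>x :: nat \<Rightarrow> int. (\<forall>i<k. x i \<in> A) \<and> inj_on x {0..<k} \<and>
           (\<Sum>i<k. c i * x i) mod p = 0)"

text \<open>Underlying undirected graph of Cay(F_p, A): distinct u, v adjacent iff
  v - u in A or u - v in A (mod p). Loops (from 0 in A) are ignored.\<close>
definition cay_adj :: "int \<Rightarrow> int set \<Rightarrow> int \<Rightarrow> int \<Rightarrow> bool" where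
  "cay_adj p A u v \<longleftrightarrow> u \<noteq> v \<and> ((v - u) mod p \<in> A \<or> (u - v) mod p \<in> A)"

definition cay_colourable :: "int \<Rightarrow> int set \<Rightarrow> nat \<Rightarrow> bool" where
  "cay_colourable p A C \<longleftrightarrow>
     (\<exists>f :: int \<Rightarrow> nat. (\<forall>u\<in>{0..<p}. f u < C) \<and>
        (\<forall>u\<in>{0..<p}. \<forall>v\<in>{0..<p}. cay_adj p A u v \<longrightarrow> f u \<noteq> f v))"

end

theory Submission
  imports Defs "HOL-Analysis.Convex" "HOL-Library.FuncSet"
begin

text \<open>
  Write \<open>T(s)\<close> for the number of solutions of \<open>\<Sum>i\<in>I. c\<^sub>i x\<^sub>i = s\<close> in \<open>A\<close>. Since the coefficients in \<open>I\<close>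
  sum to zero and \<open>|I| \<ge> 3\<close>, a Varnavides-type strengthening of Roth's theorem gives
  \<open>T(0) \<ge> \<gamma> p\<^bsup>|I|-1\<^esup>\<close>. As \<open>T\<close> is a convolution of at least three indicator functions, it hardly
  changes under shifts that almost preserve, in \<open>L\<^sup>1\<close>, the convolution \<open>g\<close> of the first two. Colour \<open>u\<close>
  according to which of boundedly many \<open>L\<^sup>1\<close>-balls contain the translates of \<open>g\<close> by \<open>c\<^sub>i u\<close>,
  \<open>i \<notin> I\<close>. Were there \<open>k - |I|\<close> elements of \<open>A\<close> that are differences of equally coloured
  points, one could put them into the slots outside \<open>I\<close> and still complete them to a
  nondegenerate solution. So inside each colour class the Cayley graph has degree at most
  \<open>2k\<close>, and greedy colouring finishes.

  No Fourier analysis is used: translates of a convolution form a totally bounded set because a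
  random sample of boundedly many points determines, up to a small error, the image of a
  Boolean function under a bounded kernel. The same fact drives the density increment in the
  proof of Roth's theorem.
\<close>

section \<open>Sampling, coverings and greedy colouring\<close>

text \<open>Why three slots: boundedly many balls cover the translates of a two-fold convolution
  only in the L1 norm, which says nothing about a single value. At least one further factor, bounded
  by a power of p, turns the L1 estimate for \<open>g\<close> into a pointwise one for T. With m =
  |I|, degenerate solutions number only O(p^(m-2)) against T(s) of order p^(m-1), so distinctness
  costs nothing for large p; small p get a colour for each vertex.

  Why the bounds are uniform: the relative error of a sample of size k is about 1/sqrt k, whatever
  the size of the sampled set, and a Boolean function shows at most 2^k patterns on it. Hence the
  number of colours depends on the error alone and not on p or A.

  Why Roth is proved over the integers: the density increment passes to a short progression, and an
  affine map makes that an interval again, whereas a prime field has no proper subgroup except 0 to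
  pass to. Progressions modulo p carry the result back.\<close>

lemma sum_lists_length_Suc:
  fixes f :: "'a list \<Rightarrow> 'b::comm_monoid_add"
  shows "(\<Sum>t | set t \<subseteq> X \<and> length t = Suc k. f t) =
    (\<Sum>x\<in>X. \<Sum>t | set t \<subseteq> X \<and> length t = k. f (x # t))"
proof -
  let ?L = "\<lambda>k. {t. set t \<subseteq> X \<and> length t = k}"
  have "(\<Sum>t\<in>?L (Suc k). f t) = (\<Sum>(x, t) \<in> X \<times> ?L k. f (x # t))"
    by (rule sum.reindex_bij_witness[where i = "\<lambda>(x, t). x # t" and j = "\<lambda>t. (hd t, tl t)"])
       (auto simp: length_Suc_conv)
  also have "\<dots> = (\<Sum>x\<in>X. \<Sum>t\<in>?L k. f (x # t))"
    by (simp add: sum.cartesian_product)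
  finally show ?thesis .
qed

text \<open>Second moment of a sum of k independent uniform draws: the cross terms vanish because
  \<open>\<psi>\<close> has mean zero. The offset \<open>s\<close> carries the entries already drawn
  through the induction; for k = 0 the truncated exponent is harmless, its term having the factor
  k.\<close>

lemma sum_lists_square:
  fixes \<psi> :: "'a \<Rightarrow> real"
  assumes "finite X" "(\<Sum>x\<in>X. \<psi> x) = 0"
  shows "(\<Sum>t | set t \<subseteq> X \<and> length t = k. (s + (\<Sum>x\<leftarrow>t. \<psi> x))\<^sup>2) =
    real (card X) ^ k * s\<^sup>2 + k * real (card X) ^ (k - 1) * (\<Sum>x\<in>X. (\<psi> x)\<^sup>2)"
proof (induction k arbitrary: s)
  case 0
  have "{t. set t \<subseteq> X \<and> length t = 0} = {[]}" by auto
  then show ?case by simp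
next
  case (Suc k)
  let ?n = "real (card X)" and ?S = "\<Sum>x\<in>X. (\<psi> x)\<^sup>2"
  have "(\<Sum>t | set t \<subseteq> X \<and> length t = Suc k. (s + (\<Sum>x\<leftarrow>t. \<psi> x))\<^sup>2) =
      (\<Sum>x\<in>X. \<Sum>t | set t \<subseteq> X \<and> length t = k. ((s + \<psi> x) + (\<Sum>x\<leftarrow>t. \<psi> x))\<^sup>2)"
    by (simp add: sum_lists_length_Suc add.assoc)
  also have "\<dots> = (\<Sum>x\<in>X. ?n ^ k * (s + \<psi> x)\<^sup>2 + k * ?n ^ (k - 1) * ?S)"
    by (simp only: Suc)
  also have "\<dots> = ?n ^ k * (\<Sum>x\<in>X. (s + \<psi> x)\<^sup>2) + ?n * (k * ?n ^ (k - 1) * ?S)"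
    by (simp add: sum.distrib sum_distrib_left)
  also have "(\<Sum>x\<in>X. (s + \<psi> x)\<^sup>2) = ?n * s\<^sup>2 + 2 * s * (\<Sum>x\<in>X. \<psi> x) + ?S"
    by (simp add: power2_sum sum.distrib mult.assoc flip: sum_distrib_left)
  also have "?n * (k * ?n ^ (k - 1) * ?S) = k * ?n ^ k * ?S"
    by (cases k) simp_all
  finally show ?case unfolding assms(2) by (simp add: distrib_left distrib_right)
qed

text \<open>Cauchy-Schwarz turns the variance from \<open>sum_lists_square\<close> into a bound on
  the mean absolute error. Relative to the scale k * card X of the two quantities compared, the
  error is 1/sqrt k, independent of the size of \<open>X\<close>.\<close>

lemma sample_sum_error:
  fixes \<phi> :: "'a \<Rightarrow> real"
  assumes "finite X" "\<And>x. x \<in> X \<Longrightarrow> \<bar>\<phi> x\<bar> \<le> 1"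
  shows "(\<Sum>t | set t \<subseteq> X \<and> length t = k.
      \<bar>real (card X) * (\<Sum>x\<leftarrow>t. \<phi> x) - real k * (\<Sum>x\<in>X. \<phi> x)\<bar>)
    \<le> real (card X) ^ k * (sqrt k * card X)"
proof (cases "k = 0 \<or> X = {}")
  case True
  then show ?thesis
  proof
    assume "k = 0"
    moreover have "{t. set t \<subseteq> X \<and> length t = 0} = {[]}" by auto
    ultimately show ?thesis by simp
  next
    assume X: "X = {}"
    show ?thesis by (simp add: X)
  qed
next
  case False
  define n where "n = real (card X)"
  define m where "m = (\<Sum>x\<in>X. \<phi> x)"
  define \<psi> where "\<psi> = (\<lambda>x. n * \<phi> x - m)"
  let ?L = "{t. set t \<subseteq> X \<and> length t = k}"
  have L: "finite ?L" "real (card ?L) = n ^ k"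
    using assms(1) by (auto simp: finite_lists_length_eq card_lists_length_eq n_def)
  have n0: "n > 0" using False assms(1) by (auto simp: n_def card_gt_0_iff)
  have \<psi>0: "(\<Sum>x\<in>X. \<psi> x) = 0"
    by (simp add: \<psi>_def sum_subtractf n_def m_def flip: sum_distrib_left)
  have eq: "n * (\<Sum>x\<leftarrow>t. \<phi> x) - real k * m = (\<Sum>x\<leftarrow>t. \<psi> x)" if "length t = k" for t
  proof -
    have "(\<Sum>x\<leftarrow>t. \<psi> x) = n * (\<Sum>x\<leftarrow>t. \<phi> x) - real (length t) * m"
      by (induction t) (auto simp: \<psi>_def algebra_simps)
    with that show ?thesis by simp
  qed
  have "(\<Sum>x\<in>X. (\<psi> x)\<^sup>2) = n\<^sup>2 * (\<Sum>x\<in>X. (\<phi> x)\<^sup>2) - n * m\<^sup>2"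
  proof -
    have "(\<Sum>x\<in>X. (\<psi> x)\<^sup>2) = (\<Sum>x\<in>X. n\<^sup>2 * (\<phi> x)\<^sup>2 + m\<^sup>2 - 2 * n * m * \<phi> x)"
      by (simp add: \<psi>_def power2_diff power_mult_distrib mult_ac)
    also have "\<dots> = n\<^sup>2 * (\<Sum>x\<in>X. (\<phi> x)\<^sup>2) + n * m\<^sup>2 - 2 * n * m * m"
      by (simp add: sum.distrib sum_subtractf n_def flip: sum_distrib_left m_def)
    finally show ?thesis by (simp add: power2_eq_square)
  qed
  also have "\<dots> \<le> n\<^sup>2 * (\<Sum>x\<in>X. (\<phi> x)\<^sup>2)"
    using n0 by simp
  also have "\<dots> \<le> n\<^sup>2 * (\<Sum>x\<in>X. 1)"
    using assms(2) by (intro mult_left_mono sum_mono) (simp_all add: abs_square_le_1)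
  also have "\<dots> = n ^ 3" by (simp add: n_def power2_eq_square power3_eq_cube)
  finally have S: "(\<Sum>x\<in>X. (\<psi> x)\<^sup>2) \<le> n ^ 3" .
  have "(\<Sum>t\<in>?L. \<bar>\<Sum>x\<leftarrow>t. \<psi> x\<bar>\<^sup>2) = k * n ^ (k - 1) * (\<Sum>x\<in>X. (\<psi> x)\<^sup>2)"
    using sum_lists_square[OF assms(1) \<psi>0, of 0 k] by (simp add: n_def)
  also have "\<dots> \<le> k * n ^ (k - 1) * n ^ 3"
    using S n0 by (intro mult_left_mono) auto
  also have "\<dots> = k * n ^ k * n ^ 2"
    using False by (cases k) (auto simp: power2_eq_square power3_eq_cube)
  finally have T: "(\<Sum>t\<in>?L. \<bar>\<Sum>x\<leftarrow>t. \<psi> x\<bar>\<^sup>2) \<le> k * n ^ k * n ^ 2" .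
  have "(\<Sum>t\<in>?L. \<bar>n * (\<Sum>x\<leftarrow>t. \<phi> x) - real k * m\<bar>)\<^sup>2 = (\<Sum>t\<in>?L. \<bar>\<Sum>x\<leftarrow>t. \<psi> x\<bar>)\<^sup>2"
    using eq by simp
  also have "\<dots> \<le> n ^ k * (\<Sum>t\<in>?L. \<bar>\<Sum>x\<leftarrow>t. \<psi> x\<bar>\<^sup>2)"
    using sum_squared_le_sum_of_squares[of "\<lambda>t. \<bar>\<Sum>x\<leftarrow>t. \<psi> x\<bar>" ?L]
    unfolding L(2) by (simp only: mult.commute)
  also have "\<dots> \<le> n ^ k * (k * n ^ k * n ^ 2)"
    using T n0 by (intro mult_left_mono) auto
  also have "\<dots> = (n ^ k * (sqrt k * n))\<^sup>2"
    by (simp add: power_mult_distrib power2_eq_square)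
  finally have "(\<Sum>t\<in>?L. \<bar>n * (\<Sum>x\<leftarrow>t. \<phi> x) - real k * m\<bar>)\<^sup>2 \<le> (n ^ k * (sqrt k * n))\<^sup>2" .
  then have "(\<Sum>t\<in>?L. \<bar>n * (\<Sum>x\<leftarrow>t. \<phi> x) - real k * m\<bar>) \<le> n ^ k * (sqrt k * n)"
    by (rule power2_le_imp_le) (use n0 in simp)
  then show ?thesis by (simp add: n_def m_def)
qed

text \<open>Some sample \<open>t\<close> does no worse than average over all \<open>U\<close> and
  \<open>Z\<close> together, and by Markov's inequality at least half of \<open>U\<close> is then
  approximated within twice the mean error. More than 2^k indices survive, so two of them agree on
  \<open>t\<close>. The threshold for \<open>card U\<close> involves neither \<open>X\<close> nor
  \<open>Z\<close>.\<close>

lemma kernel_images_close: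
  fixes K :: "'x \<Rightarrow> 'z \<Rightarrow> real" and h :: "'w \<Rightarrow> 'x \<Rightarrow> bool"
  assumes X: "finite X" "X \<noteq> {}" and Z: "finite Z" and U: "card U > 2 * 2 ^ k" and k: "k > 0"
    and K: "\<And>x z. \<bar>K x z\<bar> \<le> 1"
  obtains u v where "u \<in> U" "v \<in> U" "u \<noteq> v"
    "(\<Sum>z\<in>Z. \<bar>(\<Sum>x\<in>X. of_bool (h u x) * K x z) - (\<Sum>x\<in>X. of_bool (h v x) * K x z)\<bar>)
      \<le> 4 / sqrt k * card X * card Z"
proof -
  define n where "n = real (card X)"
  define m where "m = (\<lambda>u z. \<Sum>x\<in>X. of_bool (h u x) * K x z)"
  define e where "e = (\<lambda>u t z. \<bar>n * (\<Sum>x\<leftarrow>t. of_bool (h u x) * K x z) - k * m u z\<bar>)"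
  define b where "b = card Z * (sqrt k * n)"
  let ?L = "{t. set t \<subseteq> X \<and> length t = k}"
  have n0: "n > 0" using X by (auto simp: n_def card_gt_0_iff)
  have finU: "finite U" using U by (intro card_ge_0_finite) auto
  have L: "finite ?L" "real (card ?L) = n ^ k"
    using X(1) by (auto simp: finite_lists_length_eq card_lists_length_eq n_def)
  have et: "(\<Sum>t\<in>?L. e u t z) \<le> n ^ k * (sqrt k * n)" for u z
    unfolding e_def m_def n_def
    using K by (intro sample_sum_error[OF X(1)]) (auto simp: abs_mult)
  have "(\<Sum>t\<in>?L. \<Sum>u\<in>U. \<Sum>z\<in>Z. e u t z) = (\<Sum>u\<in>U. \<Sum>z\<in>Z. \<Sum>t\<in>?L. e u t z)"
    unfolding sum.swap[of _ _ ?L] by (rule refl)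
  also have "\<dots> \<le> (\<Sum>u\<in>U. \<Sum>z\<in>Z. n ^ k * (sqrt k * n))"
    by (intro sum_mono et)
  also have "\<dots> = (\<Sum>t\<in>?L. card U * b)"
    using L by (simp add: b_def)
  finally obtain t where t: "t \<in> ?L" "(\<Sum>u\<in>U. \<Sum>z\<in>Z. e u t z) \<le> card U * b"
  proof -
    assume *: "(\<Sum>t\<in>?L. \<Sum>u\<in>U. \<Sum>z\<in>Z. e u t z) \<le> (\<Sum>t\<in>?L. card U * b)"
    have "real (card ?L) > 0" unfolding L(2) using n0 by simp
    then have "?L \<noteq> {}" by (metis card.empty less_irrefl of_nat_0)
    then have "\<exists>t\<in>?L. (\<Sum>u\<in>U. \<Sum>z\<in>Z. e u t z) \<le> card U * b"
      using * sum_strict_mono[OF L(1), of "\<lambda>_. card U * b" "\<lambda>t. \<Sum>u\<in>U. \<Sum>z\<in>Z. e u t z"]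
      by (meson not_le)
    then show ?thesis using that by blast
  qed
  \<comment> \<open>Images that are well approximated from the sample \<open>t\<close> are determined, up to the error,
    by the \<open>k\<close> bits of \<open>h u\<close> on \<open>t\<close>.\<close>
  define good where "good = {u\<in>U. (\<Sum>z\<in>Z. e u t z) \<le> 2 * b}"
  have b0: "b \<ge> 0" using n0 by (simp add: b_def)
  have e0: "(\<Sum>z\<in>Z. e u t z) \<ge> 0" for u by (intro sum_nonneg) (simp add: e_def)
  \<comment> \<open>Markov's inequality. It divides by \<open>b\<close>, which is zero only when
    \<open>Z\<close> is empty; then all errors vanish and every index is good.\<close>
  have good: "real (card U) \<le> 2 * card good"
  proof (cases "b = 0")
    case True
    then have "(\<Sum>u\<in>U. \<Sum>z\<in>Z. e u t z) = 0"
      using t(2) sum_nonneg[of U "\<lambda>u. \<Sum>z\<in>Z. e u t z", OF e0] by simp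
    then have "\<forall>u\<in>U. (\<Sum>z\<in>Z. e u t z) = 0"
      using sum_nonneg_eq_0_iff[OF finU, of "\<lambda>u. \<Sum>z\<in>Z. e u t z"] e0 by simp
    then have "good = U" using True by (auto simp: good_def)
    then show ?thesis by simp
  next
    case False
    have "(card U - card good) * (2 * b) = (\<Sum>u\<in>U - good. 2 * b)"
      using finU by (subst sum_constant, subst card_Diff_subset) (auto simp: good_def)
    also have "\<dots> \<le> (\<Sum>u\<in>U - good. \<Sum>z\<in>Z. e u t z)"
      by (intro sum_mono) (auto simp: good_def)
    also have "\<dots> \<le> (\<Sum>u\<in>U. \<Sum>z\<in>Z. e u t z)"
      using finU e0 by (intro sum_mono2) auto
    finally have "real (card U - card good) * (2 * b) \<le> card U * b"
      using t(2) by simp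
    then have "real (card U - card good) * 2 \<le> card U"
      using False b0 by (simp add: mult.assoc[symmetric])
    moreover have "card good \<le> card U" using finU by (intro card_mono) (auto simp: good_def)
    ultimately show ?thesis by (simp add: of_nat_diff)
  qed
  have "card ((\<lambda>u. map (h u) t) ` good) \<le> card {xs :: bool list. set xs \<subseteq> UNIV \<and> length xs = k}"
    using t(1) by (intro card_mono finite_lists_length_eq) auto
  also have "\<dots> = 2 ^ k"
    by (subst card_lists_length_eq) simp_all
  also have "\<dots> < card good" using good U by linarith
  finally have "\<not> inj_on (\<lambda>u. map (h u) t) good" by (rule pigeonhole)
  then obtain u v where uv: "u \<in> good" "v \<in> good" "u \<noteq> v" and h: "map (h u) t = map (h v) t"
    by (auto simp: inj_on_def)
  from h have same: "(\<Sum>x\<leftarrow>t. of_bool (h u x) * K x z) = (\<Sum>x\<leftarrow>t. of_bool (h v x) * K x z)" for z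
    by (intro arg_cong[where f = sum_list]) auto
  have "k * (\<Sum>z\<in>Z. \<bar>m u z - m v z\<bar>) = (\<Sum>z\<in>Z. \<bar>k * m u z - k * m v z\<bar>)"
    by (simp add: sum_distrib_left abs_mult flip: right_diff_distrib)
  also have "\<dots> \<le> (\<Sum>z\<in>Z. e u t z + e v t z)"
    unfolding e_def same by (intro sum_mono) linarith
  also have "\<dots> \<le> 2 * b + 2 * b"
    using uv by (auto simp: sum.distrib good_def intro: add_mono)
  also have "2 * b + 2 * b = k * (4 / sqrt k * n * card Z)"
  proof -
    have k': "k * (4 / sqrt k) = 4 * sqrt k"
      using real_div_sqrt[of k] by (simp only: times_divide_eq_right mult.commute[of _ 4])
        (simp only: times_divide_eq_right[symmetric])
    have "k * (4 / sqrt k * n * card Z) = (k * (4 / sqrt k)) * n * card Z"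
      by (simp only: mult.assoc)
    then show ?thesis unfolding k' by (simp add: b_def)
  qed
  finally have "(\<Sum>z\<in>Z. \<bar>m u z - m v z\<bar>) \<le> 4 / sqrt k * n * card Z"
    by (rule mult_left_le_imp_le) (use k in simp)
  moreover have "u \<in> U" "v \<in> U" using uv by (simp_all add: good_def)
  ultimately show ?thesis using uv(3) that[of u v] unfolding m_def n_def by blast
qed

text \<open>A maximal separated set is a net with fewer than \<open>W\<close> points; each point is
  coloured by a nearby net point. Passing through the common net point doubles the radius.\<close>

lemma packing_imp_covering:
  fixes d :: "'a \<Rightarrow> 'a \<Rightarrow> real"
  assumes U: "finite U"
    and packing: "\<And>S. S \<subseteq> U \<Longrightarrow> card S \<ge> W \<Longrightarrow> \<exists>u\<in>S. \<exists>v\<in>S. u \<noteq> v \<and> d u v \<le> \<eta>"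
    and sym: "\<And>u v. d u v = d v u" and refl: "\<And>u. d u u \<le> \<eta>"
    and triangle: "\<And>u v w. d u w \<le> d u v + d v w"
  obtains col :: "'a \<Rightarrow> nat" where "\<And>u. u \<in> U \<Longrightarrow> col u < W"
    "\<And>u v. u \<in> U \<Longrightarrow> v \<in> U \<Longrightarrow> col u = col v \<Longrightarrow> d u v \<le> 2 * \<eta>"
proof -
  define sep where "sep = (\<lambda>S. S \<subseteq> U \<and> (\<forall>u\<in>S. \<forall>v\<in>S. u \<noteq> v \<longrightarrow> d u v > \<eta>))"
  have sep_card: "card S < W" if "sep S" for S
    using that packing[of S] by (force simp: sep_def)
  have "sep {}" by (simp add: sep_def)
  then obtain S where S: "sep S" and max: "\<And>T. sep T \<Longrightarrow> card T \<le> card S"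
    using ex_has_greatest_nat[of sep "{}" card W] sep_card by blast
  have finS: "finite S" using S U by (auto simp: sep_def intro: finite_subset)
  have near: "\<exists>s\<in>S. d u s \<le> \<eta>" if u: "u \<in> U" for u
  proof (rule ccontr)
    assume *: "\<not> (\<exists>s\<in>S. d u s \<le> \<eta>)"
    then have "u \<notin> S" using refl by blast
    moreover have "sep (insert u S)"
    proof -
      have "d u v > \<eta> \<and> d v u > \<eta>" if "v \<in> S" for v
        using * that sym[of u v] by force
      then show ?thesis using S u by (simp add: sep_def)
    qed
    ultimately show False using max[of "insert u S"] finS by simp
  qed
  then obtain c where c: "\<And>u. u \<in> U \<Longrightarrow> c u \<in> S \<and> d u (c u) \<le> \<eta>" by metis
  obtain h :: "'a \<Rightarrow> nat" where h: "bij_betw h S {0..<card S}"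
    using ex_bij_betw_finite_nat[OF finS] by blast
  show ?thesis
  proof (rule that[of "h \<circ> c"])
    fix u assume "u \<in> U"
    then have "h (c u) \<in> {0..<card S}" using h c by (auto simp: bij_betw_def)
    then show "(h \<circ> c) u < W" using sep_card[OF S] by simp
  next
    fix u v assume uv: "u \<in> U" "v \<in> U" "(h \<circ> c) u = (h \<circ> c) v"
    then have "c u = c v" using h c by (auto simp: bij_betw_def inj_on_def)
    then have "d u (c u) \<le> \<eta>" "d (c u) v \<le> \<eta>"
      using c[of u] c[of v] uv sym[of "c u" v] by simp_all
    then show "d u v \<le> 2 * \<eta>" using triangle[of u v "c u"] by simp
  qed
qed

lemma greedy_colouring:
  assumes "finite V" and sym: "\<And>u v. E u v \<Longrightarrow> E v u"
    and deg: "\<And>u. u \<in> V \<Longrightarrow> card {v\<in>V. E u v} \<le> d" and irr: "\<And>u. \<not> E u u"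
  obtains f :: "'a \<Rightarrow> nat" where "\<And>u. f u \<le> d" "\<And>u v. u \<in> V \<Longrightarrow> v \<in> V \<Longrightarrow> E u v \<Longrightarrow> f u \<noteq> f v"
proof -
  have "\<exists>f::'a \<Rightarrow> nat. (\<forall>u. f u \<le> d) \<and> (\<forall>u\<in>V. \<forall>v\<in>V. E u v \<longrightarrow> f u \<noteq> f v)"
    using assms(1) deg
  proof (induction V rule: finite_induct)
    case empty
    then show ?case by auto
  next
    case (insert a V)
    have "card {v\<in>V. E u v} \<le> d" if "u \<in> V" for u
    proof -
      have "card {v\<in>V. E u v} \<le> card {v\<in>insert a V. E u v}"
        using insert.hyps by (intro card_mono) auto
      then show ?thesis using insert.prems[of u] that by simp
    qed
    with insert.IH obtain f :: "'a \<Rightarrow> nat"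
      where f: "\<And>u. f u \<le> d" "\<And>u v. u \<in> V \<Longrightarrow> v \<in> V \<Longrightarrow> E u v \<Longrightarrow> f u \<noteq> f v"
      by blast
    have "card (f ` {v\<in>V. E a v}) \<le> card {v\<in>V. E a v}"
      using insert.hyps by (intro card_image_le) auto
    also have "\<dots> \<le> card {v\<in>insert a V. E a v}"
      using insert.hyps by (intro card_mono) auto
    also have "\<dots> \<le> d" using insert.prems by simp
    finally have "card (f ` {v\<in>V. E a v}) < card {..d}" by simp
    then have "\<not> {..d} \<subseteq> f ` {v\<in>V. E a v}"
      using insert.hyps card_mono[of "f ` {v\<in>V. E a v}" "{..d}"] by auto
    then obtain c where c: "c \<le> d" "c \<notin> f ` {v\<in>V. E a v}"
      by auto
    have ne: "f v \<noteq> c" if "v \<in> V" "E a v \<or> E v a" for v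
      using c(2) that sym by blast
    have "\<forall>u\<in>insert a V. \<forall>v\<in>insert a V. E u v \<longrightarrow> (f(a := c)) u \<noteq> (f(a := c)) v"
    proof (intro ballI impI)
      fix u v assume "u \<in> insert a V" "v \<in> insert a V" "E u v"
      then show "(f(a := c)) u \<noteq> (f(a := c)) v"
        using f(2)[of u v] ne[of u] ne[of v] irr by (cases "u = a"; cases "v = a") auto
    qed
    moreover have "\<forall>u. (f(a := c)) u \<le> d" using c f by auto
    ultimately show ?case by blast
  qed
  then show ?thesis using that by blast
qed

section \<open>Almost periodicity of weighted means\<close>

text \<open>The number of pairs \<open>(x, y)\<close> in \<open>A \<times> A\<close> with \<open>a x + b y = (a + b) z\<close>, for \<open>b \<noteq> 0\<close>.\<close>

definition convex_rep :: "int \<Rightarrow> int \<Rightarrow> int set \<Rightarrow> int \<Rightarrow> real" where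
  "convex_rep a b A z = (\<Sum>x\<in>A. of_bool ((a + b) * z - a * x \<in> (*) b ` A))"

lemma convex_rep_nonneg: "convex_rep a b A z \<ge> 0"
  by (simp add: convex_rep_def sum_nonneg)

lemma convex_rep_le: "convex_rep a b A z \<le> card A"
proof -
  have "convex_rep a b A z \<le> (\<Sum>x\<in>A. 1)"
    unfolding convex_rep_def by (intro sum_mono) simp
  then show ?thesis by simp
qed

text \<open>A weighted mean with positive weights of points of an interval stays in the interval.
  This bounded support is what makes the later shifts free of boundary terms.\<close>

lemma convex_rep_eq_0:
  assumes "A \<subseteq> {0..<N}" "a > 0" "b > 0" "z \<notin> {0..<N}"
  shows "convex_rep a b A z = 0"
proof -
  have "(a + b) * z - a * x \<noteq> b * y" if "x \<in> A" "y \<in> A" for x y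
  proof
    assume eq: "(a + b) * z - a * x = b * y"
    have xy: "0 \<le> x" "x < N" "0 \<le> y" "y < N" using that assms(1) by auto
    have "0 \<le> a * x + b * y" using xy assms by simp
    moreover have "a * x + b * y < a * N + b * N"
      using xy assms by (intro add_strict_mono mult_strict_left_mono)
    ultimately have "0 \<le> (a + b) * z" "(a + b) * z < (a + b) * N"
      using eq by (simp_all add: algebra_simps)
    then show False using assms by (simp add: zero_le_mult_iff)
  qed
  then show ?thesis unfolding convex_rep_def by (intro sum.neutral) auto
qed

text \<open>The almost period \<open>d\<close> may depend on \<open>A\<close>, but its bound
  \<open>D\<close> depends only on the weights and \<open>\<eta>\<close>. Quantifying over all
  finite \<open>S\<close> bounds the l1 norm over all integers, so that the estimate can be
  translated and iterated.\<close>

lemma convex_rep_almost_periodic: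
  fixes \<eta> :: real
  assumes ab: "a > 0" "b > 0" and "\<eta> > 0"
  obtains D N0 :: int where "D > 0"
    "\<And>N A. N \<ge> N0 \<Longrightarrow> A \<subseteq> {0..<N} \<Longrightarrow> \<exists>d. 0 < d \<and> d \<le> D \<and>
      (\<forall>S. finite S \<longrightarrow> (\<Sum>z\<in>S. \<bar>convex_rep a b A z - convex_rep a b A (z + d)\<bar>) \<le> \<eta> * (real_of_int N)\<^sup>2)"
proof -
  define q where "q = a + b"
  obtain k :: nat where k: "(16 / \<eta>)\<^sup>2 \<le> k" "k > 0"
    using reals_Archimedean2[of "(16 / \<eta>)\<^sup>2"] by (metis less_eq_real_def of_nat_0_less_iff zero_le_power2 le_less_trans)
  define W :: int where "W = 2 * 2 ^ k + 1"
  have W: "W > 0" by (simp add: W_def add_pos_pos)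
  have "16 / \<eta> \<le> sqrt k" using k by (intro real_le_rsqrt)
  then have k4: "4 / sqrt k * 4 \<le> \<eta>"
    using k \<open>\<eta> > 0\<close> by (simp add: field_simps)
  show ?thesis
  proof (rule that[of "a * W" "q * W + 2 * a * W"])
    show "a * W > 0" using ab W by simp
    fix N A assume N: "N \<ge> q * W + 2 * a * W" and A: "A \<subseteq> {0..<N}"
    \<comment> \<open>Shifting \<open>z\<close> by \<open>a w\<close> amounts to shifting the summation variable by \<open>(a + b) w\<close>, so the
      shifts of \<open>convex_rep\<close> are images of Boolean functions under one fixed kernel.\<close>
    define X where "X = {- (q * W)..<N}"
    define Z where "Z = {- (2 * a * W)..<N}"
    define h where "h = (\<lambda>w x. x + q * w \<in> A)"
    define K :: "int \<Rightarrow> int \<Rightarrow> real" where "K = (\<lambda>x z. of_bool (q * z - a * x \<in> (*) b ` A))"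
    let ?G = "convex_rep a b A"
    have pos: "q * W > 0" "a * W > 0" using ab W by (auto simp: q_def add_pos_pos)
    have finA: "finite A" using A finite_subset by blast
    have G: "(\<Sum>x\<in>X. of_bool (h w x) * K x z) = ?G (z + a * w)" if w: "w \<in> {0..<W}" for w z
    proof -
      have qw: "0 \<le> q * w" "q * w \<le> q * W" using w ab by (auto simp: q_def)
      have "(\<Sum>x\<in>X. of_bool (h w x) * K x z) = (\<Sum>x\<in>{x\<in>X. h w x}. K x z)"
        by (rule sum.mono_neutral_cong_right) (auto simp: X_def)
      also have "\<dots> = (\<Sum>x\<in>A. K (x - q * w) z)"
        by (rule sum.reindex_bij_witness[where i = "\<lambda>x. x - q * w" and j = "\<lambda>x. x + q * w"])
          (use A qw in \<open>force simp: X_def h_def\<close>)+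
      also have "\<dots> = ?G (z + a * w)"
        by (simp add: convex_rep_def K_def q_def algebra_simps)
      finally show ?thesis .
    qed
    have cards: "card {0..<W} > 2 * 2 ^ k"
      by (simp add: W_def nat_add_distrib nat_mult_distrib nat_power_eq)
    obtain u v where uv: "u \<in> {0..<W}" "v \<in> {0..<W}" "u \<noteq> v"
      and close: "(\<Sum>z\<in>Z. \<bar>(\<Sum>x\<in>X. of_bool (h u x) * K x z) - (\<Sum>x\<in>X. of_bool (h v x) * K x z)\<bar>)
        \<le> 4 / sqrt k * card X * card Z"
    proof (rule kernel_images_close[of X Z k "{0..<W}" K h])
      show "X \<noteq> {}" using pos N by (auto simp: X_def)
    qed (use cards k in \<open>auto simp: X_def Z_def K_def\<close>)
    have "int (card X) \<le> 2 * N" "int (card Z) \<le> 2 * N" and N0: "N > 0"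
      using pos N by (auto simp: X_def Z_def)
    then have "real (card X) \<le> 2 * N" "real (card Z) \<le> 2 * N"
      by linarith+
    with N0 have "4 / sqrt k * card X * card Z \<le> 4 / sqrt k * (2 * N) * (2 * N)"
      by (intro mult_mono) auto
    also have "\<dots> = (4 / sqrt k * 4) * (real_of_int N)\<^sup>2" by (simp add: power2_eq_square)
    also have "\<dots> \<le> \<eta> * (real_of_int N)\<^sup>2" using k4 by (intro mult_right_mono) auto
    finally have bound: "(\<Sum>z\<in>Z. \<bar>?G (z + a * u) - ?G (z + a * v)\<bar>) \<le> \<eta> * (real_of_int N)\<^sup>2"
      using close unfolding G[OF uv(1)] G[OF uv(2)] by (rule order_trans[rotated])
    have *: "\<exists>d. 0 < d \<and> d \<le> a * W \<and>
        (\<forall>S. finite S \<longrightarrow> (\<Sum>z\<in>S. \<bar>?G z - ?G (z + d)\<bar>) \<le> \<eta> * (real_of_int N)\<^sup>2)"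
      if uv: "u \<in> {0..<W}" "v \<in> {0..<W}" "u < v"
        and bound: "(\<Sum>z\<in>Z. \<bar>?G (z + a * u) - ?G (z + a * v)\<bar>) \<le> \<eta> * (real_of_int N)\<^sup>2" for u v
    proof (intro exI[of _ "a * (v - u)"] conjI allI impI)
      show "0 < a * (v - u)" "a * (v - u) \<le> a * W" using uv ab by auto
      have au: "0 \<le> a * u" "a * u \<le> a * W" "0 \<le> a * v" "a * v \<le> a * W" using uv ab by auto
      fix S :: "int set" assume S: "finite S"
      define T where "T = (\<lambda>z. z - a * u) ` S"
      have T: "finite T" using S by (simp add: T_def)
      have "(\<Sum>z\<in>S. \<bar>?G z - ?G (z + a * (v - u))\<bar>) = (\<Sum>z\<in>T. \<bar>?G (z + a * u) - ?G (z + a * v)\<bar>)"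
        unfolding T_def by (subst sum.reindex) (auto simp: inj_on_def algebra_simps)
      also have "\<dots> = (\<Sum>z\<in>T \<inter> Z. \<bar>?G (z + a * u) - ?G (z + a * v)\<bar>)"
      proof (rule sum.mono_neutral_right[OF T])
        show "\<forall>z\<in>T - T \<inter> Z. \<bar>?G (z + a * u) - ?G (z + a * v)\<bar> = 0"
        proof
          fix z assume "z \<in> T - T \<inter> Z"
          then have "z + a * u \<notin> {0..<N}" "z + a * v \<notin> {0..<N}"
            using au by (auto simp: Z_def)
          then show "\<bar>?G (z + a * u) - ?G (z + a * v)\<bar> = 0"
            using convex_rep_eq_0[OF A ab] by simp
        qed
      qed auto
      also have "\<dots> \<le> (\<Sum>z\<in>Z. \<bar>?G (z + a * u) - ?G (z + a * v)\<bar>)"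
        by (intro sum_mono2) (auto simp: Z_def)
      finally show "(\<Sum>z\<in>S. \<bar>?G z - ?G (z + a * (v - u))\<bar>) \<le> \<eta> * (real_of_int N)\<^sup>2"
        using bound by simp
    qed
    show "\<exists>d. 0 < d \<and> d \<le> a * W \<and>
        (\<forall>S. finite S \<longrightarrow> (\<Sum>z\<in>S. \<bar>?G z - ?G (z + d)\<bar>) \<le> \<eta> * (real_of_int N)\<^sup>2)"
    proof (cases "u < v")
      case True
      then show ?thesis using *[OF uv(1,2)] bound by blast
    next
      case False
      then have "v < u" using uv(3) by simp
      then show ?thesis using *[OF uv(2,1)] bound by (simp add: abs_minus_commute)
    qed
  qed
qed

text \<open>Not every pair has an integral weighted mean, but pairs within one residue class modulo
  a + b do, since a x + b y = (a + b) x - b (x - y). The fullest class has at least card A / (a + b)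
  elements, and distinct pairs from it are counted separately.\<close>

lemma convex_rep_sum_ge:
  assumes ab: "a > 0" "b > 0" and A: "A \<subseteq> {0..<N}"
  shows "(\<Sum>z\<in>{0..<N}. convex_rep a b A z) \<ge> (real (card A))\<^sup>2 / (real_of_int (a + b))\<^sup>2"
proof -
  define q where "q = a + b"
  have q: "q > 0" using ab by (simp add: q_def)
  have finA: "finite A" using A finite_subset by blast
  have "\<exists>r\<in>{0..<q}. real (card A) / q \<le> card {x\<in>A. x mod q = r}"
  proof (rule ccontr)
    assume *: "\<not> ?thesis"
    have "real (card A) = real (\<Sum>r\<in>{0..<q}. card {x\<in>A. x mod q = r})"
    proof -
      have "(\<lambda>x. x mod q) ` A \<subseteq> {0..<q}" using q by auto
      then show ?thesis
        using finA sum.group[of A "{0..<q}" "\<lambda>x. x mod q" "\<lambda>_. 1::nat"] by simp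
    qed
    also have "\<dots> = (\<Sum>r\<in>{0..<q}. real (card {x\<in>A. x mod q = r}))" by simp
    also have "\<dots> < (\<Sum>r\<in>{0..<q}. card A / q)"
      using * q by (intro sum_strict_mono) (auto simp: not_le)
    also have "\<dots> = card A" using q by simp
    finally show False by simp
  qed
  then obtain r where r: "real (card A) / q \<le> card {x\<in>A. x mod q = r}" by blast
  define B where "B = {x\<in>A. x mod q = r}"
  have B: "B \<subseteq> A" "finite B" using finA by (auto simp: B_def)
  have row: "real (card B) \<le> (\<Sum>z\<in>{0..<N}. of_bool (q * z - a * x \<in> (*) b ` A))" if x: "x \<in> B" for x
  proof -
    define g where "g = (\<lambda>y. (a * x + b * y) div q)"
    have g: "q * g y = a * x + b * y" if y: "y \<in> B" for y
    proof -
      have "q dvd x - y" using x y mod_eq_dvd_iff[of x q y] by (simp add: B_def)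
      then have "q dvd q * x - b * (x - y)" by simp
      moreover have "q * x - b * (x - y) = a * x + b * y" by (simp add: q_def algebra_simps)
      ultimately have "q dvd a * x + b * y" by metis
      then show ?thesis by (simp add: g_def)
    qed
    have "inj_on g B"
    proof (rule inj_onI)
      fix y y' assume "y \<in> B" "y' \<in> B" "g y = g y'"
      then have "a * x + b * y = a * x + b * y'" using g by metis
      then show "y = y'" using ab by simp
    qed
    moreover have "g ` B \<subseteq> {z\<in>{0..<N}. q * z - a * x \<in> (*) b ` A}"
    proof (intro image_subsetI CollectI conjI)
      fix y assume y: "y \<in> B"
      then show im: "q * g y - a * x \<in> (*) b ` A" using g B by auto
      have "0 \<le> x" "x < N" "0 \<le> y" "y < N" using x y B A by auto
      then have "0 \<le> a * x + b * y" "a * x + b * y < a * N + b * N"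
        using ab by (auto intro!: add_strict_mono)
      then have "0 \<le> q * g y" "q * g y < q * N"
        using g[OF y] by (simp_all add: q_def algebra_simps)
      then show "g y \<in> {0..<N}" using q by (simp add: zero_le_mult_iff)
    qed
    ultimately have "card B \<le> card {z\<in>{0..<N}. q * z - a * x \<in> (*) b ` A}"
      by (rule card_inj_on_le) (rule finite_subset[of _ "{0..<N}"], auto)
    also have "real \<dots> = (\<Sum>z\<in>{0..<N}. of_bool (q * z - a * x \<in> (*) b ` A))"
      by (subst sum_of_bool_eq) (auto intro!: arg_cong[of _ _ card])
    finally show ?thesis by simp
  qed
  have "(real (card A) / q)\<^sup>2 \<le> (real (card B))\<^sup>2"
    using r q by (intro power_mono) (auto simp: B_def)
  also have "\<dots> = (\<Sum>x\<in>B. real (card B))" by (simp add: power2_eq_square)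
  also have "\<dots> \<le> (\<Sum>x\<in>B. \<Sum>z\<in>{0..<N}. of_bool (q * z - a * x \<in> (*) b ` A))"
    by (intro sum_mono row)
  also have "\<dots> \<le> (\<Sum>x\<in>A. \<Sum>z\<in>{0..<N}. of_bool (q * z - a * x \<in> (*) b ` A))"
    using B finA by (intro sum_mono2 sum_nonneg) auto
  also have "\<dots> = (\<Sum>z\<in>{0..<N}. convex_rep a b A z)"
    unfolding convex_rep_def q_def by (rule sum.swap)
  finally show ?thesis by (simp add: q_def power_divide)
qed

section \<open>Roth's theorem by density increment\<close>

definition has_nontrivial_rep :: "int \<Rightarrow> int \<Rightarrow> int set \<Rightarrow> bool" where
  "has_nontrivial_rep a b A \<longleftrightarrow> (\<exists>x\<in>A. \<exists>y\<in>A. \<exists>z\<in>A. x \<noteq> y \<and> a * x + b * y = (a + b) * z)"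

text \<open>A single length \<open>N\<close> suffices: nontrivial solutions are preserved by
  injective affine maps, so the statement applies to any progression of \<open>N\<close>
  terms.\<close>

definition forcing_density :: "int \<Rightarrow> int \<Rightarrow> real \<Rightarrow> bool" where
  "forcing_density a b \<alpha> \<longleftrightarrow> (\<exists>N::nat. N > 0 \<and>
     (\<forall>A. A \<subseteq> {0..<int N} \<longrightarrow> real (card A) \<ge> \<alpha> * N \<longrightarrow> has_nontrivial_rep a b A))"

lemma has_nontrivial_rep_progression:
  assumes "d \<noteq> 0" "has_nontrivial_rep a b {j. y + j * d \<in> A \<and> P j}"
  shows "has_nontrivial_rep a b A"
proof -
  obtain i j l where "y + i * d \<in> A" "y + j * d \<in> A" "y + l * d \<in> A" "i \<noteq> j"
    and eq: "a * i + b * j = (a + b) * l"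
    using assms(2) by (auto simp: has_nontrivial_rep_def)
  moreover have "a * (y + i * d) + b * (y + j * d) = (a + b) * (y + l * d)"
  proof -
    have "a * (y + i * d) + b * (y + j * d) = (a + b) * y + (a * i + b * j) * d"
      by (simp add: algebra_simps)
    then show ?thesis unfolding eq by (simp add: algebra_simps)
  qed
  ultimately show ?thesis using assms(1) unfolding has_nontrivial_rep_def
    by (metis add_left_cancel mult_cancel_right)
qed

lemma convex_rep_le_1:
  assumes "finite A" "\<not> has_nontrivial_rep a b A" "z \<in> A" "a + b \<noteq> 0"
  shows "convex_rep a b A z \<le> 1"
proof -
  have "x = z" if "x \<in> A" "y \<in> A" "(a + b) * z - a * x = b * y" for x y
  proof -
    have eq: "a * x + b * y = (a + b) * z" using that by simp
    then have "x = y" using assms(2,3) that unfolding has_nontrivial_rep_def by blast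
    with eq have "(a + b) * x = (a + b) * z" by (simp add: algebra_simps)
    then show "x = z" using assms(4) by simp
  qed
  then have "convex_rep a b A z \<le> (\<Sum>x\<in>A. of_bool (x = z))"
    unfolding convex_rep_def by (intro sum_mono) (auto simp: of_bool_def)
  also have "\<dots> = 1" using assms by (simp add: of_bool_def)
  finally show ?thesis .
qed

text \<open>Telescoping: each further step by \<open>d\<close> costs \<open>c\<close>, because the
  hypothesis also covers the translate of \<open>S\<close> reached so far.\<close>

lemma shift_iterate:
  fixes g :: "int \<Rightarrow> real"
  assumes "\<And>S. finite S \<Longrightarrow> (\<Sum>z\<in>S. \<bar>g z - g (z + d)\<bar>) \<le> c" "finite S"
  shows "(\<Sum>z\<in>S. \<bar>g z - g (z - int j * d)\<bar>) \<le> j * c"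
proof (induction j)
  case (Suc j)
  define T where "T = (\<lambda>z. z - int (Suc j) * d) ` S"
  have "(\<Sum>z\<in>S. \<bar>g z - g (z - int (Suc j) * d)\<bar>) \<le>
      (\<Sum>z\<in>S. \<bar>g z - g (z - int j * d)\<bar> + \<bar>g (z - int (Suc j) * d) - g (z - int j * d)\<bar>)"
    by (intro sum_mono) linarith
  also have "\<dots> = (\<Sum>z\<in>S. \<bar>g z - g (z - int j * d)\<bar>) + (\<Sum>z\<in>T. \<bar>g z - g (z + d)\<bar>)"
    unfolding T_def by (subst sum.reindex) (auto simp: inj_on_def sum.distrib algebra_simps)
  also have "\<dots> \<le> j * c + c"
    using assms(1)[of T] assms(2) Suc by (intro add_mono) (auto simp: T_def)
  finally show ?case by (simp add: algebra_simps)
qed simp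

text \<open>If \<open>A\<close> has only trivial solutions, its balanced function \<open>f\<close> correlates negatively with the
  almost periodic function \<open>convex_rep\<close>. Averaging \<open>f\<close> over progressions whose step is an almost
  period preserves this correlation, and as \<open>f\<close> has mean zero, the average is large and positive
  on some progression.\<close>

lemma density_increment:
  assumes ab: "a > 0" "b > 0" and \<alpha>: "0 < \<alpha>" "\<alpha> \<le> \<beta>"
    and inc: "forcing_density a b (\<beta> + \<alpha> ^ 3 / (8 * (real_of_int (a + b))\<^sup>2))"
  shows "forcing_density a b \<beta>"
proof -
  define q where "q = real_of_int (a + b)"
  \<comment> \<open>The lower bound from \<open>convex_rep_sum_ge\<close> is worth 2 \<delta> N^2.
    Trivial solutions leave \<delta> N^2, replacing shifts by almost periods leaves half of that,
    and half of what then remains is the increment \<delta>/4.\<close>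
  define \<delta> where "\<delta> = \<alpha> ^ 3 / (2 * q\<^sup>2)"
  have q: "q > 0" using ab by (simp add: q_def)
  have \<delta>: "\<delta> > 0" using q \<alpha> by (simp add: \<delta>_def)
  have "\<alpha> ^ 3 / (8 * (real_of_int (a + b))\<^sup>2) = \<delta> / 4" by (simp add: \<delta>_def q_def)
  with inc obtain M :: nat where M: "M > 0"
    and MA: "\<And>A. A \<subseteq> {0..<int M} \<Longrightarrow> real (card A) \<ge> (\<beta> + \<delta> / 4) * M \<Longrightarrow> has_nontrivial_rep a b A"
    unfolding forcing_density_def by metis
  \<comment> \<open>Fewer than \<open>M\<close> shifts, each costing \<eta> N^2, lose at most
    \<delta>/2 N^2 in total.\<close>
  define \<eta> where "\<eta> = \<delta> / (2 * M)"
  have \<eta>: "\<eta> > 0" using \<delta> M by (simp add: \<eta>_def)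
  obtain D N0 :: int where D: "D > 0" and per: "\<And>N A. N \<ge> N0 \<Longrightarrow> A \<subseteq> {0..<N} \<Longrightarrow> \<exists>d. 0 < d \<and> d \<le> D \<and>
      (\<forall>S. finite S \<longrightarrow> (\<Sum>z\<in>S. \<bar>convex_rep a b A z - convex_rep a b A (z + d)\<bar>) \<le> \<eta> * (real_of_int N)\<^sup>2)"
    by (rule convex_rep_almost_periodic[OF ab \<eta>]) blast
  \<comment> \<open>In turn: almost periodicity applies; the at most N trivial solutions cost less
    than \<delta> N^2; the boundary error 2 M D stays below \<delta> N / 4; a progression of
    \<open>M\<close> steps fits into the interval.\<close>
  obtain N :: nat where "max (max (real_of_int N0) (2 * q\<^sup>2 / \<alpha> ^ 3)) (max (8 * M * D / \<delta>) (real_of_int (int M * D))) < N"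
    using reals_Archimedean2 by blast
  then have N: "int N \<ge> N0" "2 * q\<^sup>2 / \<alpha> ^ 3 < N" "8 * M * D / \<delta> < N" "int M * D < int N"
    by linarith+
  have "0 < int M * D" using M D by simp
  then have N_pos: "N > 0" using N(4) by linarith
  show ?thesis
    unfolding forcing_density_def
  proof (intro exI[of _ N] conjI allI impI N_pos)
    fix A assume A: "A \<subseteq> {0..<int N}" and dens: "real (card A) \<ge> \<beta> * N"
    show "has_nontrivial_rep a b A"
    proof (rule ccontr)
      assume triv: "\<not> has_nontrivial_rep a b A"
      let ?S = "{0..<int N}" and ?G = "convex_rep a b A"
      define \<gamma> where "\<gamma> = card A / N"
      define f where "f = (\<lambda>z. if z \<in> ?S then of_bool (z \<in> A) - \<gamma> else 0)"
      have finA: "finite A" using A finite_subset by blast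
      have "card A \<le> N" using card_mono[OF _ A] by simp
      then have \<gamma>: "\<beta> \<le> \<gamma>" "\<gamma> \<le> 1" "\<gamma> * N = card A"
        using N_pos dens by (auto simp: \<gamma>_def field_simps)
      have \<gamma>0: "\<gamma> > 0" using \<gamma> \<alpha> by simp
      have f_le: "\<bar>f z\<bar> \<le> 1" for z using \<gamma> \<gamma>0 by (auto simp: f_def)
      have sum_A: "(\<Sum>z\<in>?S. of_bool (z \<in> A) * g z) = (\<Sum>z\<in>A. g z)" for g :: "int \<Rightarrow> real"
        using A by (intro sum.mono_neutral_cong_right) auto
      have f_sum: "(\<Sum>z\<in>?S. f z) = 0"
        using sum_A[of "\<lambda>_. 1"] \<gamma> by (simp add: f_def sum_subtractf mult.commute)
      obtain d where d: "0 < d" "d \<le> D"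
        and dS: "\<And>S. finite S \<Longrightarrow> (\<Sum>z\<in>S. \<bar>?G z - ?G (z + d)\<bar>) \<le> \<eta> * (real N)\<^sup>2"
        using per[OF N(1) A] by auto
      have jd: "0 \<le> int j * d" "int j * d \<le> int M * D" if "j < M" for j
        using that d D by (auto intro: mult_mono)
      define F where "F = (\<lambda>y. \<Sum>j<M. f (y + int j * d))"
      have F_le: "F y \<le> M" for y
      proof -
        have "F y \<le> (\<Sum>j<M. 1)" unfolding F_def using f_le by (intro sum_mono) (simp add: abs_le_iff)
        then show ?thesis by simp
      qed
      \<comment> \<open>A larger value would give \<open>A\<close> density above \<beta> +
        \<delta>/4 on this progression, where \<open>MA\<close> forces a nontrivial solution. Near
        the right end the progression may leave the interval, and only the trivial bound
        \<open>F_le\<close> is available.\<close>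
      have F_int: "F y \<le> \<delta> / 4 * M" if y: "0 \<le> y" "y < int N - int M * D" for y
      proof (rule ccontr)
        assume *: "\<not> F y \<le> \<delta> / 4 * M"
        have in_S: "y + int j * d \<in> ?S" if "j < M" for j
          using jd[OF that] y by auto
        let ?J = "{j. y + j * d \<in> A \<and> j \<in> {0..<int M}}"
        have "F y = (\<Sum>j<M. of_bool (y + int j * d \<in> A) - \<gamma>)"
          unfolding F_def by (intro sum.cong) (use in_S in \<open>auto simp: f_def\<close>)
        also have "\<dots> = card {j\<in>{..<M}. y + int j * d \<in> A} - M * \<gamma>"
          by (simp add: sum_subtractf Int_def)
        also have "card {j\<in>{..<M}. y + int j * d \<in> A} = card ?J"
          by (rule bij_betw_same_card[of int], rule bij_betw_byWitness[of _ nat]) auto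
        finally have "card ?J > M * \<gamma> + \<delta> / 4 * M" using * by simp
        moreover have "(\<beta> + \<delta> / 4) * M \<le> M * \<gamma> + \<delta> / 4 * M"
          using mult_right_mono[OF \<gamma>(1), of M] by (simp add: algebra_simps)
        ultimately have "has_nontrivial_rep a b ?J" by (intro MA) auto
        with d(1) have "has_nontrivial_rep a b A"
          using has_nontrivial_rep_progression[of d a b y A "\<lambda>j. j \<in> {0..<int M}"] by simp
        then show False using triv by blast
      qed
      have corr: "\<delta> * (real N)\<^sup>2 \<le> - (\<Sum>z\<in>?S. f z * ?G z)"
      proof -
        have "(\<Sum>z\<in>A. ?G z) \<le> (\<Sum>z\<in>A. 1)"
          using convex_rep_le_1[OF finA triv] ab by (intro sum_mono) auto
        then have 1: "(\<Sum>z\<in>A. ?G z) \<le> N" using \<open>card A \<le> N\<close> by simp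
        have "\<alpha> ^ 3 / q\<^sup>2 * (real N)\<^sup>2 \<le> \<gamma> ^ 3 / q\<^sup>2 * (real N)\<^sup>2"
          using \<alpha> \<gamma> by (intro mult_right_mono divide_right_mono power_mono) auto
        also have "\<dots> = \<gamma> * ((real (card A))\<^sup>2 / q\<^sup>2)"
          by (simp add: \<gamma>(3)[symmetric] power_mult_distrib power2_eq_square power3_eq_cube)
        also have "\<dots> \<le> \<gamma> * (\<Sum>z\<in>?S. ?G z)"
          using convex_rep_sum_ge[OF ab A] \<gamma>0 by (intro mult_left_mono) (auto simp: q_def)
        finally have 2: "2 * \<delta> * (real N)\<^sup>2 \<le> \<gamma> * (\<Sum>z\<in>?S. ?G z)" by (simp add: \<delta>_def)
        have "1 < \<delta> * N" using N(2) q \<alpha> by (simp add: \<delta>_def field_simps)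
        then have 3: "real N \<le> \<delta> * (real N)\<^sup>2"
          using mult_right_mono[of 1 "\<delta> * N" "real N"] by (simp add: power2_eq_square mult.assoc)
        have "(\<Sum>z\<in>?S. f z * ?G z) = (\<Sum>z\<in>?S. of_bool (z \<in> A) * ?G z - \<gamma> * ?G z)"
          by (intro sum.cong) (auto simp: f_def algebra_simps)
        also have "\<dots> = (\<Sum>z\<in>A. ?G z) - \<gamma> * (\<Sum>z\<in>?S. ?G z)"
          by (simp only: sum_subtractf sum_A sum_distrib_left)
        finally show ?thesis using 1 2 3 by linarith
      qed
      have shifted: "\<delta> / 2 * (real N)\<^sup>2 \<le> - (\<Sum>y\<in>?S. f (y + int j * d) * ?G y)" if j: "j < M" for j
      proof -
        \<comment> \<open>The range can be extended on the left because \<open>?G\<close> vanishes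
          there, and cut on the right because \<open>f\<close> does.\<close>
        have "(\<Sum>y\<in>?S. f (y + int j * d) * ?G y) = (\<Sum>y\<in>{- (int j * d)..<int N}. f (y + int j * d) * ?G y)"
          using jd[OF j] convex_rep_eq_0[OF A ab] by (intro sum.mono_neutral_left) auto
        also have "\<dots> = (\<Sum>y\<in>{- (int j * d)..<int N - int j * d}. f (y + int j * d) * ?G y)"
          using jd[OF j] by (intro sum.mono_neutral_right) (auto simp: f_def)
        also have "\<dots> = (\<Sum>z\<in>?S. f z * ?G (z - int j * d))"
          by (rule sum.reindex_bij_witness[where i = "\<lambda>z. z - int j * d" and j = "\<lambda>y. y + int j * d"]) auto
        finally have "(\<Sum>y\<in>?S. f (y + int j * d) * ?G y) - (\<Sum>z\<in>?S. f z * ?G z) =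
            (\<Sum>z\<in>?S. f z * (?G (z - int j * d) - ?G z))"
          by (simp add: sum_subtractf algebra_simps)
        also have "\<dots> \<le> (\<Sum>z\<in>?S. \<bar>?G z - ?G (z - int j * d)\<bar>)"
        proof (rule sum_mono)
          fix z
          have "f z * (?G (z - int j * d) - ?G z) \<le> \<bar>f z\<bar> * \<bar>?G (z - int j * d) - ?G z\<bar>"
            by (simp flip: abs_mult)
          also have "\<dots> \<le> 1 * \<bar>?G (z - int j * d) - ?G z\<bar>" using f_le by (intro mult_right_mono) auto
          finally show "f z * (?G (z - int j * d) - ?G z) \<le> \<bar>?G z - ?G (z - int j * d)\<bar>" by simp
        qed
        also have "\<dots> \<le> j * (\<eta> * (real N)\<^sup>2)" by (rule shift_iterate[OF dS]) auto
        also have "\<dots> \<le> M * (\<eta> * (real N)\<^sup>2)" using j \<eta> by (intro mult_right_mono) auto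
        also have "\<dots> = \<delta> / 2 * (real N)\<^sup>2" using M by (simp add: \<eta>_def)
        finally show ?thesis using corr by linarith
      qed
      have "M * (\<delta> / 2 * (real N)\<^sup>2) = (\<Sum>j<M. \<delta> / 2 * (real N)\<^sup>2)" by simp
      also have "\<dots> \<le> (\<Sum>j<M. - (\<Sum>y\<in>?S. f (y + int j * d) * ?G y))"
        using shifted by (intro sum_mono) auto
      also have "\<dots> = (\<Sum>y\<in>?S. - F y * ?G y)"
        by (simp add: F_def sum_negf sum_distrib_right sum.swap[of _ ?S])
      \<comment> \<open>As 0 <= ?G y <= N, the summand is at most N times the negative part of
        \<open>F y\<close>. Writing that as the positive part minus \<open>F y\<close> brings in the
        upper bounds on \<open>F\<close>, and the sum of \<open>F\<close> itself is almost
        zero.\<close>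
      also have "\<dots> \<le> (\<Sum>y\<in>?S. N * (\<delta> / 4 * M + real M * of_bool (y \<ge> int N - int M * D) - F y))"
      proof (rule sum_mono)
        fix y assume y: "y \<in> ?S"
        have G: "0 \<le> ?G y" "?G y \<le> N"
          using convex_rep_nonneg[of a b A y] convex_rep_le[of a b A y] \<open>card A \<le> N\<close> by linarith+
        have "max (F y) 0 \<le> \<delta> / 4 * M + real M * of_bool (y \<ge> int N - int M * D)"
        proof -
          have "0 \<le> \<delta> / 4 * M" using \<delta> by simp
          then show ?thesis
            using F_int[of y] F_le[of y] y by (cases "y \<ge> int N - int M * D") (auto simp: not_le)
        qed
        moreover have "- F y * ?G y \<le> N * (max (F y) 0 - F y)"
        proof (cases "F y \<ge> 0")
          case True
          then show ?thesis using G by (simp add: max_def)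
        next
          case False
          then have "- F y * ?G y \<le> - F y * N" using G by (intro mult_left_mono) auto
          then show ?thesis using False by (simp add: max_def mult.commute)
        qed
        moreover have "N * (max (F y) 0 - F y) \<le> N * (\<delta> / 4 * M + real M * of_bool (y \<ge> int N - int M * D) - F y)"
          using calculation(1) by (intro mult_left_mono) auto
        ultimately show "- F y * ?G y \<le> N * (\<delta> / 4 * M + real M * of_bool (y \<ge> int N - int M * D) - F y)"
          by linarith
      qed
      also have "\<dots> = N * (N * (\<delta> / 4 * M) + real M * (\<Sum>y\<in>?S. of_bool (y \<ge> int N - int M * D)) - (\<Sum>y\<in>?S. F y))"
        by (simp add: sum.distrib sum_subtractf flip: sum_distrib_left)
      also have "\<dots> \<le> N * (N * (\<delta> / 4 * M) + M * (real M * real_of_int D) - (- (M * (real M * real_of_int D))))"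
      proof (intro mult_left_mono diff_mono add_mono order_refl)
        have "(\<Sum>y\<in>?S. of_bool (y \<ge> int N - int M * D)) = (\<Sum>y\<in>{int N - int M * D..<int N}. 1::real)"
          using N(4) by (intro sum.mono_neutral_cong_right) auto
        also have "\<dots> = real_of_int (int M * D)" using M D by (simp del: of_int_mult)
        finally show "(\<Sum>y\<in>?S. of_bool (y \<ge> int N - int M * D)) \<le> real M * real_of_int D" by simp
        \<comment> \<open>Since \<open>f\<close> has total zero, the shifted sum is, up to sign, the
          sum over the at most M D points pushed out of the interval.\<close>
        have "- (real M * real_of_int D) \<le> (\<Sum>y\<in>?S. f (y + int j * d))" if j: "j < M" for j
        proof -
          have "(\<Sum>y\<in>?S. f (y + int j * d)) = (\<Sum>z\<in>{int j * d..<int N + int j * d}. f z)"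
            by (rule sum.reindex_bij_witness[where i = "\<lambda>z. z - int j * d" and j = "\<lambda>y. y + int j * d"]) auto
          also have "\<dots> = (\<Sum>z\<in>{int j * d..<int N}. f z)"
            using jd[OF j] by (intro sum.mono_neutral_right) (auto simp: f_def)
          also have "\<dots> = - (\<Sum>z\<in>{0..<int j * d}. f z)"
          proof -
            have "?S = {0..<int j * d} \<union> {int j * d..<int N}" using jd[OF j] N(4) by auto
            then have "(\<Sum>z\<in>?S. f z) = (\<Sum>z\<in>{0..<int j * d}. f z) + (\<Sum>z\<in>{int j * d..<int N}. f z)"
              by (metis finite_atLeastLessThan_int ivl_disj_int_two(3) sum.union_disjoint)
            then show ?thesis using f_sum by simp
          qed
          also have "\<dots> \<ge> - (\<Sum>z\<in>{0..<int j * d}. 1)"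
            using f_le by (intro le_imp_neg_le sum_mono) (simp add: abs_le_iff)
          finally have "- real_of_int (int j * d) \<le> (\<Sum>y\<in>?S. f (y + int j * d))"
            using jd[OF j] by simp
          moreover have "real_of_int (int j * d) \<le> real_of_int (int M * D)"
            using jd[OF j] by (simp only: of_int_le_iff)
          ultimately show ?thesis by simp
        qed
        then have "(\<Sum>j<M. - (real M * real_of_int D)) \<le> (\<Sum>j<M. \<Sum>y\<in>?S. f (y + int j * d))"
          by (intro sum_mono) auto
        then show "- (real M * (real M * real_of_int D)) \<le> (\<Sum>y\<in>?S. F y)"
          by (simp add: F_def sum.swap[of _ ?S])
      qed (use \<delta> in auto)
      finally have "(real M * N) * (\<delta> / 4 * N) \<le> (real M * N) * (2 * M * D)"
        by (simp add: power2_eq_square algebra_simps)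
      then have "\<delta> / 4 * N \<le> 2 * M * D"
        using M N_pos by simp
      moreover have "\<delta> * N > 8 * M * D" using N(3) \<delta> by (simp add: field_simps)
      ultimately show False by simp
    qed
  qed
qed

text \<open>The gain \<open>\<kappa>\<close> depends on the lower bound \<open>\<alpha>\<close> and
  not on the current density, so finitely many increments lead down to \<open>\<alpha>\<close> from
  a density above 1, which no subset of a one-point interval attains.\<close>

lemma forcing_density_pos:
  assumes ab: "a > 0" "b > 0" and \<alpha>: "0 < \<alpha>"
  shows "forcing_density a b \<alpha>"
proof -
  define \<kappa> where "\<kappa> = \<alpha> ^ 3 / (8 * (real_of_int (a + b))\<^sup>2)"
  have \<kappa>: "\<kappa> > 0" using ab \<alpha> by (simp add: \<kappa>_def)
  have top: "forcing_density a b \<beta>" if "\<beta> > 1" for \<beta>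
    unfolding forcing_density_def
  proof (intro exI[of _ "1::nat"] conjI allI impI)
    fix A :: "int set" assume "A \<subseteq> {0..<int 1}" "\<beta> * real 1 \<le> real (card A)"
    moreover from this have "card A \<le> 1" using card_mono[of "{0..<int 1}" A] by simp
    ultimately show "has_nontrivial_rep a b A" using that by linarith
  qed simp
  have "forcing_density a b \<beta>" if "\<beta> + n * \<kappa> > 1" "\<alpha> \<le> \<beta>" for \<beta> and n :: nat
    using that
  proof (induction n arbitrary: \<beta>)
    case 0
    then show ?case using top by simp
  next
    case (Suc n)
    have "forcing_density a b (\<beta> + \<kappa>)"
      by (rule Suc.IH) (use Suc.prems \<kappa> in \<open>auto simp: algebra_simps\<close>)
    then show ?case using density_increment[OF ab \<alpha> Suc.prems(2)] by (simp add: \<kappa>_def)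
  qed
  moreover obtain n :: nat where "1 < n * \<kappa>" using reals_Archimedean3[OF \<kappa>] by blast
  ultimately show ?thesis using \<alpha> by (metis add_strict_increasing less_eq_real_def order_refl)
qed

section \<open>Counting solutions modulo a prime\<close>

text \<open>Two of three nonzero integers have the same sign. After a rotation these come first, and
  up to a global sign the equation is a x + b y = (a + b) z with positive weights. There x and y
  being distinct already makes all three entries distinct.\<close>

lemma forcing_zero_sum_triple:
  fixes c1 c2 c3 :: int and \<alpha> :: real
  assumes "c1 \<noteq> 0" "c2 \<noteq> 0" "c3 \<noteq> 0" "c1 + c2 + c3 = 0" "\<alpha> > 0"
  shows "\<exists>N::nat. N > 0 \<and> (\<forall>A. A \<subseteq> {0..<int N} \<longrightarrow> real (card A) \<ge> \<alpha> * N \<longrightarrow>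
    (\<exists>x\<in>A. \<exists>y\<in>A. \<exists>z\<in>A. x \<noteq> y \<and> x \<noteq> z \<and> y \<noteq> z \<and> c1 * x + c2 * y + c3 * z = 0))"
proof -
  define P where "P = (\<lambda>c1 c2 c3 :: int. \<exists>N::nat. N > 0 \<and>
    (\<forall>A. A \<subseteq> {0..<int N} \<longrightarrow> real (card A) \<ge> \<alpha> * N \<longrightarrow>
    (\<exists>x\<in>A. \<exists>y\<in>A. \<exists>z\<in>A. x \<noteq> y \<and> x \<noteq> z \<and> y \<noteq> z \<and> c1 * x + c2 * y + c3 * z = 0)))"
  have distinct: "x \<noteq> z \<and> y \<noteq> z \<and> - a * x + - b * y + (a + b) * z = 0 \<and> a * x + b * y + (- (a + b)) * z = 0"
    if "a > 0" "b > 0" "x \<noteq> y" "a * x + b * y = (a + b) * z" for a b x y z :: int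
  proof -
    have "x \<noteq> z"
    proof
      assume "x = z"
      with that(4) have "b * y = b * x" by (simp add: distrib_right)
      with that show False by simp
    qed
    moreover have "y \<noteq> z"
    proof
      assume "y = z"
      with that(4) have "a * x = a * y" by (simp add: distrib_right)
      with that show False by simp
    qed
    moreover have "- a * x + - b * y = - (a * x + b * y)" by simp
    moreover have "(- (a + b)) * z = - ((a + b) * z)" by (rule mult_minus_left)
    ultimately show ?thesis by (simp only: that(4)) simp
  qed
  have base: "P a b (- (a + b)) \<and> P (- a) (- b) (a + b)" if ab: "a > 0" "b > 0" for a b
  proof -
    obtain N :: nat where N: "N > 0"
      "\<And>A. A \<subseteq> {0..<int N} \<Longrightarrow> real (card A) \<ge> \<alpha> * N \<Longrightarrow> has_nontrivial_rep a b A"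
      using forcing_density_pos[OF ab assms(5)] unfolding forcing_density_def by blast
    have *: "\<exists>x\<in>A. \<exists>y\<in>A. \<exists>z\<in>A. x \<noteq> y \<and> x \<noteq> z \<and> y \<noteq> z \<and>
        - a * x + - b * y + (a + b) * z = 0 \<and> a * x + b * y + (- (a + b)) * z = 0"
      if "A \<subseteq> {0..<int N}" "real (card A) \<ge> \<alpha> * N" for A
    proof -
      from N(2)[OF that] obtain x y z where "x \<in> A" "y \<in> A" "z \<in> A" "x \<noteq> y" "a * x + b * y = (a + b) * z"
        unfolding has_nontrivial_rep_def by blast
      with distinct[OF ab this(4,5)] show ?thesis by blast
    qed
    show ?thesis
      unfolding P_def
    proof (intro conjI exI[of _ N] allI impI N(1))
      fix A assume "A \<subseteq> {0..<int N}" "real (card A) \<ge> \<alpha> * N"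
      note A = *[OF this]
      show "\<exists>x\<in>A. \<exists>y\<in>A. \<exists>z\<in>A. x \<noteq> y \<and> x \<noteq> z \<and> y \<noteq> z \<and> a * x + b * y + (- (a + b)) * z = 0"
        using A by blast
      show "\<exists>x\<in>A. \<exists>y\<in>A. \<exists>z\<in>A. x \<noteq> y \<and> x \<noteq> z \<and> y \<noteq> z \<and> - a * x + - b * y + (a + b) * z = 0"
        using A by blast
    qed
  qed
  have rot: "P b c a" if "P a b c" for a b c
  proof -
    obtain N :: nat where N: "N > 0"
      "\<And>A. A \<subseteq> {0..<int N} \<Longrightarrow> real (card A) \<ge> \<alpha> * N \<Longrightarrow>
        \<exists>x\<in>A. \<exists>y\<in>A. \<exists>z\<in>A. x \<noteq> y \<and> x \<noteq> z \<and> y \<noteq> z \<and> a * x + b * y + c * z = 0"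
      using \<open>P a b c\<close> unfolding P_def by blast
    show ?thesis
      unfolding P_def
    proof (intro exI[of _ N] conjI allI impI N(1))
      fix A assume "A \<subseteq> {0..<int N}" "real (card A) \<ge> \<alpha> * N"
      from N(2)[OF this] obtain x y z where "x \<in> A" "y \<in> A" "z \<in> A" "x \<noteq> y" "x \<noteq> z" "y \<noteq> z"
        "a * x + b * y + c * z = 0" by blast
      moreover from this(7) have "b * y + c * z + a * x = 0" by simp
      ultimately show "\<exists>x\<in>A. \<exists>y\<in>A. \<exists>z\<in>A. x \<noteq> y \<and> x \<noteq> z \<and> y \<noteq> z \<and> b * x + c * y + a * z = 0"
        by metis
    qed
  qed
  have same_sign: "P a b c" if "a * b > 0" "a + b + c = 0" for a b c
  proof (cases "a > 0")
    case True
    moreover from True have "b > 0" using that(1) by (simp add: zero_less_mult_iff)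
    moreover have "c = - (a + b)" using that(2) by simp
    ultimately show ?thesis using base[of a b] by blast
  next
    case False
    then have "a < 0" "b < 0" using that by (auto simp: zero_less_mult_iff)
    moreover have "c = - a + - b" using that(2) by simp
    ultimately show ?thesis using base[of "- a" "- b"] by simp
  qed
  have "c1 * c2 > 0 \<or> c2 * c3 > 0 \<or> c3 * c1 > 0"
    using assms(1-3) by (auto simp: zero_less_mult_iff neq_iff)
  then have "P c1 c2 c3"
  proof (elim disjE)
    assume "c1 * c2 > 0" then show ?thesis using same_sign assms by simp
  next
    assume "c2 * c3 > 0" then have "P c2 c3 c1" using same_sign assms by simp
    then show ?thesis using rot by blast
  next
    assume "c3 * c1 > 0" then have "P c3 c1 c2" using same_sign assms by simp
    then show ?thesis using rot by blast
  qed
  then show ?thesis by (simp add: P_def)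
qed

text \<open>As a function of \<open>s\<close> modulo \<open>p\<close>, this is the convolution of
  the push-forwards of the indicator of \<open>A\<close> under multiplication by the coefficients.
  The list encoding lets slots be split off, merged and exchanged.\<close>

fun sol_count :: "int \<Rightarrow> int set \<Rightarrow> int list \<Rightarrow> int \<Rightarrow> real" where
  "sol_count p A [] s = of_bool (p dvd s)"
| "sol_count p A (c # cs) s = (\<Sum>x\<in>A. sol_count p A cs (s - c * x))"

definition solutions :: "int \<Rightarrow> int set \<Rightarrow> int list \<Rightarrow> int \<Rightarrow> int list set" where
  "solutions p A cs s = {xs. set xs \<subseteq> A \<and> length xs = length cs \<and> p dvd s - (\<Sum>(c, x)\<leftarrow>zip cs xs. c * x)}"

lemma finite_solutions: "finite A \<Longrightarrow> finite (solutions p A cs s)"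
  unfolding solutions_def
  by (rule finite_subset[OF _ finite_lists_length_eq[of A "length cs"]]) auto

lemma sol_count_eq_card:
  assumes "finite A"
  shows "sol_count p A cs s = card (solutions p A cs s)"
proof -
  have "sol_count p A cs s = (\<Sum>xs | set xs \<subseteq> A \<and> length xs = length cs.
      of_bool (p dvd s - (\<Sum>(c, x)\<leftarrow>zip cs xs. c * x)))"
  proof (induction cs arbitrary: s)
    case Nil
    have "{xs. set xs \<subseteq> A \<and> length xs = length []} = {[]}" by auto
    then show ?case by simp
  next
    case (Cons c cs)
    then show ?case
      by (simp add: sum_lists_length_Suc diff_diff_eq)
  qed
  also have "\<dots> = card ({xs. set xs \<subseteq> A \<and> length xs = length cs} \<inter>
      {xs. p dvd s - (\<Sum>(c, x)\<leftarrow>zip cs xs. c * x)})"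
    by (rule sum_of_bool_eq) (use assms in \<open>auto simp: finite_lists_length_eq\<close>)
  also have "{xs. set xs \<subseteq> A \<and> length xs = length cs} \<inter>
      {xs. p dvd s - (\<Sum>(c, x)\<leftarrow>zip cs xs. c * x)} = solutions p A cs s"
    by (auto simp: solutions_def)
  finally show ?thesis .
qed

lemma sol_count_nonneg: "sol_count p A cs s \<ge> 0"
  by (induction cs arbitrary: s) (auto intro: sum_nonneg)

lemma sol_count_mono:
  assumes "finite B" "A \<subseteq> B"
  shows "sol_count p A cs s \<le> sol_count p B cs s"
proof (induction cs arbitrary: s)
  case (Cons c cs)
  have "sol_count p A (c # cs) s \<le> (\<Sum>x\<in>A. sol_count p B cs (s - c * x))"
    by (simp add: sum_mono Cons)
  also have "\<dots> \<le> sol_count p B (c # cs) s"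
    using assms by (simp add: sum_mono2 sol_count_nonneg)
  finally show ?case .
qed simp

lemma sol_count_cong:
  assumes "p dvd s - t"
  shows "sol_count p A cs s = sol_count p A cs t"
  using assms
proof (induction cs arbitrary: s t)
  case Nil
  then have "s mod p = t mod p" by (simp add: mod_eq_dvd_iff)
  then show ?case by (simp add: dvd_eq_mod_eq_0)
next
  case (Cons c cs)
  then show ?case by (auto intro!: sum.cong)
qed

lemma sol_count_swap: "sol_count p A (c # d # cs) s = sol_count p A (d # c # cs) s"
  unfolding sol_count.simps by (subst sum.swap) (simp add: algebra_simps)

lemma sum_periodic_shift:
  fixes f :: "int \<Rightarrow> real"
  assumes "p > 0" "\<And>x y. p dvd x - y \<Longrightarrow> f x = f y"
  shows "(\<Sum>t\<in>{0..<p}. f (t + c)) = (\<Sum>t\<in>{0..<p}. f t)"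
proof (rule sum.reindex_bij_witness[where i = "\<lambda>t. (t - c) mod p" and j = "\<lambda>t. (t + c) mod p"])
  fix t assume t: "t \<in> {0..<p}"
  show "((t + c) mod p - c) mod p = t" "((t - c) mod p + c) mod p = t"
    using t by (simp_all add: mod_simps)
  show "(t + c) mod p \<in> {0..<p}" "(t - c) mod p \<in> {0..<p}" using assms(1) by auto
  show "f ((t + c) mod p) = f (t + c)" 
    by (rule assms(2)) (simp add: mod_eq_dvd_iff[symmetric])
qed

text \<open>Associativity of convolution modulo p: \<open>t\<close> is the part of the target
  supplied by the slots of \<open>cs\<close>.\<close>

lemma sol_count_append:
  assumes "p > 0"
  shows "sol_count p A (cs @ ds) s = (\<Sum>t\<in>{0..<p}. sol_count p A cs t * sol_count p A ds (s - t))"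
proof (induction cs arbitrary: s)
  case Nil
  have "(\<Sum>t\<in>{0..<p}. sol_count p A [] t * sol_count p A ds (s - t)) =
      (\<Sum>t\<in>{0}. sol_count p A ds (s - t))"
    using assms by (intro sum.mono_neutral_cong_right) (auto dest: zdvd_imp_le)
  then show ?case by simp
next
  case (Cons c cs)
  have "sol_count p A ((c # cs) @ ds) s =
      (\<Sum>x\<in>A. \<Sum>t\<in>{0..<p}. sol_count p A cs t * sol_count p A ds (s - c * x - t))"
    by (simp add: Cons)
  also have "\<dots> = (\<Sum>x\<in>A. \<Sum>t\<in>{0..<p}. sol_count p A cs (t - c * x) * sol_count p A ds (s - t))"
  proof (rule sum.cong[OF refl])
    fix x assume "x \<in> A"
    let ?f = "\<lambda>t. sol_count p A cs t * sol_count p A ds (s - c * x - t)"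
    have "?f u = ?f v" if "p dvd u - v" for u v
    proof -
      have "p dvd (s - c * x - u) - (s - c * x - v)"
        using that by (simp add: dvd_diff_commute)
      then show ?thesis using that sol_count_cong by metis
    qed
    from sum_periodic_shift[of p ?f, OF assms this, of "- (c * x)"]
    show "(\<Sum>t\<in>{0..<p}. ?f t) = (\<Sum>t\<in>{0..<p}. sol_count p A cs (t - c * x) * sol_count p A ds (s - t))"
      by simp
  qed
  also have "\<dots> = (\<Sum>t\<in>{0..<p}. sol_count p A (c # cs) t * sol_count p A ds (s - t))"
    by (simp add: sum_distrib_right sum.swap[of _ A])
  finally show ?case .
qed

lemma mult_mod_eq_imp_eq:
  fixes p c x y :: int
  assumes "prime p" "\<not> p dvd c" "x \<in> {0..<p}" "y \<in> {0..<p}" "p dvd c * x - c * y"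
  shows "x = y"
proof -
  have "p dvd c * (x - y)" using assms(5) by (simp add: right_diff_distrib)
  then have "p dvd x - y" using assms by (simp add: prime_dvd_mult_iff)
  then have "x mod p = y mod p" by (simp add: mod_eq_dvd_iff)
  then show ?thesis using assms by simp
qed

text \<open>All slots but the last are free, and the last one is determined because its coefficient
  is invertible modulo p.\<close>

lemma sol_count_le:
  assumes p: "prime p" and A: "A \<subseteq> {0..<p}" and "cs \<noteq> []" "\<And>c. c \<in> set cs \<Longrightarrow> \<not> p dvd c"
  shows "sol_count p A cs s \<le> real_of_int p ^ (length cs - 1)"
  using assms(3,4)
proof (induction cs arbitrary: s rule: list_nonempty_induct)
  case (single c)
  have finA: "finite A" using A finite_subset by blast
  have "card {x\<in>A. p dvd s - c * x} \<le> 1"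
  proof (rule card_le_Suc0_iff_eq[THEN iffD2, simplified One_nat_def[symmetric]])
    show "\<forall>x\<in>{x\<in>A. p dvd s - c * x}. \<forall>y\<in>{x\<in>A. p dvd s - c * x}. x = y"
    proof (intro ballI)
      fix x y assume xy: "x \<in> {x\<in>A. p dvd s - c * x}" "y \<in> {x\<in>A. p dvd s - c * x}"
      then have "p dvd (s - c * y) - (s - c * x)" by (blast intro: dvd_diff)
      then have "p dvd c * x - c * y" by simp
      then show "x = y" using xy A single p by (intro mult_mod_eq_imp_eq[of p c]) auto
    qed
  qed (use finA in auto)
  then have "(\<Sum>x\<in>A. of_bool (p dvd s - c * x)) \<le> (1::real)"
    using finA by (simp add: Int_def)
  then show ?case by simp
next
  case (cons c cs)
  have "card A \<le> nat p" using card_mono[OF _ A] by simp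
  then have cA: "real (card A) \<le> p" using prime_gt_0_int[OF p] by linarith
  have "sol_count p A (c # cs) s \<le> (\<Sum>x\<in>A. real_of_int p ^ (length cs - 1))"
    unfolding sol_count.simps using cons by (intro sum_mono) auto
  also have "\<dots> = card A * real_of_int p ^ (length cs - 1)" by simp
  also have "\<dots> \<le> p * real_of_int p ^ (length cs - 1)"
    using cA prime_gt_0_int[OF p] by (intro mult_right_mono) auto
  also have "\<dots> = real_of_int p ^ (length (c # cs) - 1)"
    using cons(1) by (cases cs) auto
  finally show ?case .
qed

section \<open>Supersaturation for zero-sum equations\<close>

text \<open>The threshold \<open>P\<close> discards primes too small for the progressions of the
  three-term case or dividing a merged coefficient. Both \<open>\<gamma>\<close> and
  \<open>P\<close> depend on the coefficients and the density only.\<close>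

definition supersaturated :: "int list \<Rightarrow> bool" where
  "supersaturated cs \<longleftrightarrow> (\<forall>\<epsilon>::real. \<epsilon> > 0 \<longrightarrow> (\<exists>\<gamma>::real. \<gamma> > 0 \<and> (\<exists>P::int. \<forall>p A. prime p \<longrightarrow> p > P \<longrightarrow>
     A \<subseteq> {0..<p} \<longrightarrow> real (card A) \<ge> \<epsilon> * real_of_int p \<longrightarrow>
     sol_count p A cs 0 \<ge> \<gamma> * real_of_int p ^ (length cs - 1))))"

lemma supersaturatedE:
  assumes "supersaturated cs" "\<epsilon> > 0"
  obtains \<gamma> P where "\<gamma> > 0" "\<And>p A. prime p \<Longrightarrow> p > P \<Longrightarrow> A \<subseteq> {0..<p} \<Longrightarrow> real (card A) \<ge> \<epsilon> * real_of_int p \<Longrightarrow>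
     sol_count p A cs 0 \<ge> \<gamma> * real_of_int p ^ (length cs - 1)"
  using assms unfolding supersaturated_def by blast

text \<open>Varnavides' averaging. For each step d, the progressions u + j d modulo p with j < N
  have mean density card A / p, so at least \<epsilon>/2 p of them have density \<epsilon>/2 and
  contain a solution. Over all nonzero d this gives at least \<epsilon>/4 p^2 progressions, and each
  solution is found at most N^3 times.\<close>

lemma supersaturated_triple:
  assumes c: "c1 \<noteq> 0" "c2 \<noteq> 0" "c3 \<noteq> 0" and sum0: "c1 + c2 + c3 = 0"
  shows "supersaturated [c1, c2, c3]"
  unfolding supersaturated_def
proof (intro allI impI)
  fix \<epsilon> :: real assume \<epsilon>: "\<epsilon> > 0"
  then have \<epsilon>2: "\<epsilon> / 2 > 0" by simp
  obtain N :: nat where N: "N > 0" and forced: "\<And>A. A \<subseteq> {0..<int N} \<Longrightarrow> real (card A) \<ge> \<epsilon> / 2 * N \<Longrightarrow>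
      \<exists>x\<in>A. \<exists>y\<in>A. \<exists>z\<in>A. x \<noteq> y \<and> x \<noteq> z \<and> y \<noteq> z \<and> c1 * x + c2 * y + c3 * z = 0"
    using forcing_zero_sum_triple[OF c sum0 \<epsilon>2] by blast
  define \<gamma> where "\<gamma> = \<epsilon> / (4 * real N ^ 3)"
  show "\<exists>\<gamma>::real. \<gamma> > 0 \<and> (\<exists>P::int. \<forall>p A. prime p \<longrightarrow> p > P \<longrightarrow>
     A \<subseteq> {0..<p} \<longrightarrow> real (card A) \<ge> \<epsilon> * real_of_int p \<longrightarrow>
     sol_count p A [c1, c2, c3] 0 \<ge> \<gamma> * real_of_int p ^ (length [c1, c2, c3] - 1))"
  proof (intro exI[of _ \<gamma>] exI[of _ "int N"] conjI allI impI)
    show "\<gamma> > 0" using \<epsilon> N by (simp add: \<gamma>_def)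
    fix p A assume p: "prime p" "p > int N" and A: "A \<subseteq> {0..<p}" and dens: "real (card A) \<ge> \<epsilon> * real_of_int p"
    have p2: "p \<ge> 2" using p(1) prime_ge_2_int by blast
    have finA: "finite A" using A finite_subset by blast
    define J where "J = (\<lambda>u d. {j\<in>{0..<int N}. (u + j * d) mod p \<in> A})"
    define good where "good = (\<lambda>d. {u\<in>{0..<p}. real (card (J u d)) \<ge> \<epsilon> / 2 * N})"
    have J_card: "real (card (J u d)) = (\<Sum>j\<in>{0..<int N}. of_bool ((u + j * d) mod p \<in> A))" for u d
      by (simp add: J_def Int_def)
    have good_card: "\<epsilon> / 2 * p \<le> card (good d)" for d
    proof -
      have row: "(\<Sum>u\<in>{0..<p}. of_bool ((u + j * d) mod p \<in> A)) = real (card A)" for j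
      proof -
        have "(\<Sum>u\<in>{0..<p}. of_bool ((u + j * d) mod p \<in> A)) = (\<Sum>u\<in>{0..<p}. of_bool (u mod p \<in> A) :: real)"
          using p2 by (intro sum_periodic_shift[where f = "\<lambda>u. of_bool (u mod p \<in> A)"]) (auto simp flip: mod_eq_dvd_iff)
        also have "\<dots> = (\<Sum>u\<in>A. 1)"
          using A by (intro sum.mono_neutral_cong_right) auto
        finally show ?thesis by simp
      qed
      have "N * real (card A) = (\<Sum>j\<in>{0..<int N}. \<Sum>u\<in>{0..<p}. of_bool ((u + j * d) mod p \<in> A))"
        unfolding row by simp
      also have "\<dots> = (\<Sum>u\<in>{0..<p}. real (card (J u d)))"
        unfolding J_card by (rule sum.swap)
      also have "\<dots> \<le> (\<Sum>u\<in>{0..<p}. \<epsilon> / 2 * N + N * of_bool (u \<in> good d))"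
      proof (rule sum_mono)
        fix u assume u: "u \<in> {0..<p}"
        have "card (J u d) \<le> N" using card_mono[of "{0..<int N}" "J u d"] by (force simp: J_def)
        then show "real (card (J u d)) \<le> \<epsilon> / 2 * N + N * of_bool (u \<in> good d)"
          using u \<epsilon> by (cases "u \<in> good d") (auto simp: good_def intro: add_increasing)
      qed
      also have "\<dots> = N * (\<epsilon> / 2 * p + card (good d))"
      proof -
        have "(\<Sum>u\<in>{0..<p}. of_bool (u \<in> good d)) = (\<Sum>u\<in>good d. 1::real)"
          by (intro sum.mono_neutral_cong_right) (auto simp: good_def)
        then show ?thesis using p2 by (simp add: sum.distrib algebra_simps flip: sum_distrib_left)
      qed
      finally have "real (card A) \<le> \<epsilon> / 2 * p + card (good d)" using N by simp
      then show ?thesis using dens by simp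
    qed
    have fin_good: "finite (good d)" for d
      by (rule finite_subset[of _ "{0..<p}"]) (auto simp: good_def)
    define G where "G = (SIGMA d:{1..<p}. good d)"
    have G_card: "real_of_int (p - 1) * (\<epsilon> / 2 * p) \<le> card G"
    proof -
      have "real_of_int (p - 1) * (\<epsilon> / 2 * p) = (\<Sum>d\<in>{1..<p}. \<epsilon> / 2 * p)" using p2 by simp
      also have "\<dots> \<le> (\<Sum>d\<in>{1..<p}. real (card (good d)))" by (intro sum_mono good_card)
      also have "\<dots> = card G" unfolding G_def using fin_good by simp
      finally show ?thesis .
    qed
    have "\<forall>g\<in>G. \<exists>t. case g of (d, u) \<Rightarrow> case t of (i, j, l) \<Rightarrow> i \<in> J u d \<and> j \<in> J u d \<and> l \<in> J u d \<and>
        i \<noteq> j \<and> c1 * i + c2 * j + c3 * l = 0"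
    proof
      fix g assume "g \<in> G"
      then obtain d u where g: "g = (d, u)" "u \<in> good d" by (auto simp: G_def)
      have "J u d \<subseteq> {0..<int N}" "real (card (J u d)) \<ge> \<epsilon> / 2 * N" using g by (auto simp: J_def good_def)
      from forced[OF this] show "\<exists>t. case g of (d, u) \<Rightarrow> case t of (i, j, l) \<Rightarrow> i \<in> J u d \<and> j \<in> J u d \<and> l \<in> J u d \<and>
        i \<noteq> j \<and> c1 * i + c2 * j + c3 * l = 0" unfolding g by auto
    qed
    from bchoice[OF this] obtain \<tau> where \<tau>_all: "\<forall>g\<in>G. case g of (d, u) \<Rightarrow> case \<tau> g of (i, j, l) \<Rightarrow>
        i \<in> J u d \<and> j \<in> J u d \<and> l \<in> J u d \<and> i \<noteq> j \<and> c1 * i + c2 * j + c3 * l = 0"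
      by (rule exE)
    have \<tau>: "i \<in> J u d \<and> j \<in> J u d \<and> l \<in> J u d \<and> i \<noteq> j \<and> c1 * i + c2 * j + c3 * l = 0"
      if "(d, u) \<in> G" "\<tau> (d, u) = (i, j, l)" for d u i j l
      using bspec[OF \<tau>_all that(1)] that(2) by simp
    \<comment> \<open>Recording the index triple beside the solution makes the map injective: the
      first two entries differ by (i - j) d, where i - j is invertible since 0 < |i - j| < N < p.
      This recovers d, and then u.\<close>
    define h where "h = (\<lambda>(d, u). case \<tau> (d, u) of (i, j, l) \<Rightarrow>
      ((i, j, l), [(u + i * d) mod p, (u + j * d) mod p, (u + l * d) mod p]))"
    let ?T = "{0..<int N} \<times> {0..<int N} \<times> {0..<int N}"
    have "inj_on h G"
    proof (rule inj_onI)
      fix g g' assume gg: "g \<in> G" "g' \<in> G" "h g = h g'"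
      obtain d u d' u' where g: "g = (d, u)" "g' = (d', u')" by (metis surj_pair)
      obtain i j l where t: "\<tau> g = (i, j, l)" by (metis surj_pair)
      have t': "\<tau> g' = (i, j, l)" using gg t by (auto simp: h_def g split: prod.splits)
      have "i \<in> {0..<int N}" "j \<in> {0..<int N}" "i \<noteq> j" using \<tau>[of d u i j l] gg t by (auto simp: g J_def)
      then have ij: "\<not> p dvd i - j"
        using p(2) dvd_imp_le_int[of "i - j" p] by auto
      have du: "d \<in> {0..<p}" "d' \<in> {0..<p}" "u \<in> {0..<p}" "u' \<in> {0..<p}"
        using gg by (auto simp: g G_def good_def)
      have "(u + i * d) mod p = (u' + i * d') mod p" "(u + j * d) mod p = (u' + j * d') mod p"
        using gg t t' by (auto simp: h_def g)
      then have e: "p dvd (u + i * d) - (u' + i * d')" "p dvd (u + j * d) - (u' + j * d')"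
        by (simp_all add: mod_eq_dvd_iff)
      have "p dvd ((u + i * d) - (u' + i * d')) - ((u + j * d) - (u' + j * d'))"
        using e by (rule dvd_diff)
      also have "((u + i * d) - (u' + i * d')) - ((u + j * d) - (u' + j * d')) = (i - j) * d - (i - j) * d'"
        by (simp add: algebra_simps)
      finally have "d = d'" using mult_mod_eq_imp_eq[OF p(1) ij du(1,2)] by simp
      with e(1) have "p dvd u - u'" by simp
      then have "u mod p = u' mod p" by (simp add: mod_eq_dvd_iff)
      then show "g = g'" using du \<open>d = d'\<close> by (simp add: g)
    qed
    moreover have "h ` G \<subseteq> ?T \<times> solutions p A [c1, c2, c3] 0"
    proof
      fix r assume "r \<in> h ` G"
      then obtain d u where du: "(d, u) \<in> G" and r: "r = h (d, u)" by auto
      obtain i j l where t: "\<tau> (d, u) = (i, j, l)" by (metis surj_pair)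
      note T = \<tau>[OF du t]
      have "c1 * (u + i * d) + c2 * (u + j * d) + c3 * (u + l * d) = (c1 + c2 + c3) * u + (c1 * i + c2 * j + c3 * l) * d"
        by (simp add: algebra_simps)
      then have "c1 * (u + i * d) + c2 * (u + j * d) + c3 * (u + l * d) = 0" using T sum0 by simp
      moreover have "(c1 * ((u + i * d) mod p) + c2 * ((u + j * d) mod p) + c3 * ((u + l * d) mod p)) mod p =
          (c1 * (u + i * d) + c2 * (u + j * d) + c3 * (u + l * d)) mod p"
        by (intro mod_add_cong mod_mult_right_eq)
      ultimately have "p dvd c1 * ((u + i * d) mod p) + c2 * ((u + j * d) mod p) + c3 * ((u + l * d) mod p)"
        by (metis dvd_eq_mod_eq_0 mod_0)
      then have "p dvd c1 * ((u + i * d) mod p) + (c2 * ((u + j * d) mod p) + c3 * ((u + l * d) mod p))"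
        by (simp only: add.assoc)
      then show "r \<in> ?T \<times> solutions p A [c1, c2, c3] 0"
        using T by (auto simp: r h_def t solutions_def J_def)
    qed
    ultimately have "card G \<le> card (?T \<times> solutions p A [c1, c2, c3] 0)"
      using finA by (intro card_inj_on_le[of h]) (auto intro: finite_solutions)
    also have "real \<dots> = real N ^ 3 * sol_count p A [c1, c2, c3] 0"
      using finA by (simp add: sol_count_eq_card card_cartesian_product power3_eq_cube del: sol_count.simps)
    finally have "card G \<le> real N ^ 3 * sol_count p A [c1, c2, c3] 0" by simp
    moreover have "\<epsilon> / 4 * (real_of_int p)\<^sup>2 \<le> real_of_int (p - 1) * (\<epsilon> / 2 * p)"
    proof -
      have "real_of_int p \<le> 2 * real_of_int (p - 1)" using p2 by simp
      then have "\<epsilon> / 4 * p * real_of_int p \<le> \<epsilon> / 4 * p * (2 * real_of_int (p - 1))"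
        using \<epsilon> p2 by (intro mult_left_mono) auto
      then show ?thesis by (simp add: power2_eq_square algebra_simps)
    qed
    ultimately have "\<epsilon> / 4 * (real_of_int p)\<^sup>2 \<le> real N ^ 3 * sol_count p A [c1, c2, c3] 0"
      using G_card by linarith
    then show "\<gamma> * real_of_int p ^ (length [c1, c2, c3] - 1) \<le> sol_count p A [c1, c2, c3] 0"
      using N by (simp add: \<gamma>_def field_simps numeral_2_eq_2[symmetric] del: sol_count.simps)
  qed
qed

text \<open>Most \<open>z \<in> A\<close> admit many representations \<open>c\<^sub>1 x + c\<^sub>2 y = (c\<^sub>1 + c\<^sub>2) z\<close> within \<open>A\<close>, for
  otherwise the set of the remaining \<open>z\<close> would contradict the three-term case.\<close>

lemma supersaturated_merge:
  assumes c: "c1 \<noteq> 0" "c2 \<noteq> 0" "c1 + c2 \<noteq> 0" and merged: "supersaturated ((c1 + c2) # cs)"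
  shows "supersaturated (c1 # c2 # cs)"
  unfolding supersaturated_def
proof (intro allI impI)
  fix \<epsilon> :: real assume \<epsilon>: "\<epsilon> > 0"
  then have \<epsilon>2: "\<epsilon> / 2 > 0" by simp
  \<comment> \<open>The coefficient of \<open>z\<close> stands first, so that unfolding one slot of
    the count sums over \<open>z\<close> the number of its representations.\<close>
  have "supersaturated [- (c1 + c2), c1, c2]" using c by (intro supersaturated_triple) auto
  then obtain \<gamma> P where \<gamma>: "\<gamma> > 0" and trip: "\<And>p A. prime p \<Longrightarrow> p > P \<Longrightarrow> A \<subseteq> {0..<p} \<Longrightarrow>
      real (card A) \<ge> \<epsilon> / 2 * real_of_int p \<Longrightarrow>
      sol_count p A [- (c1 + c2), c1, c2] 0 \<ge> \<gamma> * real_of_int p ^ (length [- (c1 + c2), c1, c2] - 1)"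
    using \<epsilon>2 by (rule supersaturatedE) blast
  obtain \<gamma>' P' where \<gamma>': "\<gamma>' > 0" and rest: "\<And>p A. prime p \<Longrightarrow> p > P' \<Longrightarrow> A \<subseteq> {0..<p} \<Longrightarrow>
      real (card A) \<ge> \<epsilon> / 2 * real_of_int p \<Longrightarrow>
      sol_count p A ((c1 + c2) # cs) 0 \<ge> \<gamma>' * real_of_int p ^ (length ((c1 + c2) # cs) - 1)"
    using merged \<epsilon>2 by (rule supersaturatedE) blast
  show "\<exists>\<gamma>::real. \<gamma> > 0 \<and> (\<exists>P::int. \<forall>p A. prime p \<longrightarrow> p > P \<longrightarrow>
     A \<subseteq> {0..<p} \<longrightarrow> real (card A) \<ge> \<epsilon> * real_of_int p \<longrightarrow>
     sol_count p A (c1 # c2 # cs) 0 \<ge> \<gamma> * real_of_int p ^ (length (c1 # c2 # cs) - 1))"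
  proof (intro exI[of _ "\<gamma> * \<gamma>'"] exI[of _ "max (max P P') \<bar>c1 + c2\<bar>"] conjI allI impI)
    show "\<gamma> * \<gamma>' > 0" using \<gamma> \<gamma>' by simp
    fix p A assume p: "prime p" and P: "p > max (max P P') \<bar>c1 + c2\<bar>"
      and A: "A \<subseteq> {0..<p}" and dens: "real (card A) \<ge> \<epsilon> * real_of_int p"
    have p0: "p > 0" using prime_gt_0_int[OF p] .
    have finA: "finite A" using A finite_subset by blast
    have cp: "\<not> p dvd c1 + c2" using c P zdvd_not_zless[of "\<bar>c1 + c2\<bar>" p] by auto
    let ?r = "\<lambda>z. sol_count p A [c1, c2] ((c1 + c2) * z)"
    define B where "B = {z\<in>A. ?r z \<ge> \<gamma> * p}"
    have B: "B \<subseteq> A" "finite B" using finA by (auto simp: B_def)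
    have "real (card (A - B)) < \<epsilon> / 2 * p"
    proof (rule ccontr)
      assume *: "\<not> ?thesis"
      then have "real (card (A - B)) > 0" using \<epsilon> p0 by (smt (verit) divide_pos_pos mult_pos_pos of_int_0_less_iff)
      then have ne: "A - B \<noteq> {}" by force
      have "\<gamma> * (real_of_int p)\<^sup>2 \<le> sol_count p (A - B) [- (c1 + c2), c1, c2] 0"
        using trip[OF p _ _ , of "A - B"] P A * by (auto simp: numeral_2_eq_2 simp del: sol_count.simps)
      also have "\<dots> = (\<Sum>z\<in>A - B. sol_count p (A - B) [c1, c2] ((c1 + c2) * z))"
        by (subst sol_count.simps) (simp del: sol_count.simps add: algebra_simps)
      also have "\<dots> \<le> (\<Sum>z\<in>A - B. ?r z)"
        using finA by (intro sum_mono sol_count_mono) auto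
      also have "\<dots> < (\<Sum>z\<in>A - B. \<gamma> * p)"
        using finA ne by (intro sum_strict_mono) (auto simp: B_def not_le simp del: sol_count.simps)
      also have "\<dots> = card (A - B) * (\<gamma> * p)" by simp
      also have "\<dots> \<le> p * (\<gamma> * p)"
      proof (rule mult_right_mono)
        have "card (A - B) \<le> nat p" using card_mono[of "{0..<p}" "A - B"] A by auto
        then show "real (card (A - B)) \<le> p" using p0 by linarith
      qed (use \<gamma> p0 in auto)
      finally show False by (simp add: power2_eq_square)
    qed
    moreover have "real (card (A - B)) = real (card A) - real (card B)"
      using B finA by (simp add: card_Diff_subset card_mono)
    ultimately have "real (card B) \<ge> \<epsilon> / 2 * p" using dens by simp
    then have "\<gamma>' * real_of_int p ^ (length ((c1 + c2) # cs) - 1) \<le> sol_count p B ((c1 + c2) # cs) 0"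
      using rest[OF p, of B] P B A by auto
    then have "\<gamma> * p * (\<gamma>' * real_of_int p ^ (length ((c1 + c2) # cs) - 1)) \<le> \<gamma> * p * sol_count p B ((c1 + c2) # cs) 0"
      using \<gamma> p0 by (intro mult_left_mono) auto
    also have "\<gamma> * p * sol_count p B ((c1 + c2) # cs) 0 = (\<Sum>z\<in>B. \<gamma> * p * sol_count p B cs (0 - (c1 + c2) * z))"
      by (simp add: sum_distrib_left)
    also have "\<dots> \<le> (\<Sum>z\<in>B. ?r z * sol_count p A cs (0 - (c1 + c2) * z))"
      using B finA by (intro sum_mono mult_mono sol_count_mono sol_count_nonneg) (auto simp: B_def simp del: sol_count.simps)
    \<comment> \<open>Replacing \<open>z\<close> by the residue of (c1 + c2) z is injective and
      embeds the sum into the convolution formula for the whole list; the other residues contribute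
      nonnegative terms.\<close>
    also have "\<dots> = (\<Sum>t\<in>(\<lambda>z. (c1 + c2) * z mod p) ` B. sol_count p A [c1, c2] t * sol_count p A cs (0 - t))"
    proof (subst sum.reindex)
      show "inj_on (\<lambda>z. (c1 + c2) * z mod p) B"
      proof (rule inj_onI)
        fix x y assume "x \<in> B" "y \<in> B" "(c1 + c2) * x mod p = (c1 + c2) * y mod p"
        then show "x = y"
          using B A by (intro mult_mod_eq_imp_eq[OF p cp]) (auto simp: mod_eq_dvd_iff)
      qed
      have "sol_count p A [c1, c2] ((c1 + c2) * z) = sol_count p A [c1, c2] ((c1 + c2) * z mod p)"
        "sol_count p A cs (0 - (c1 + c2) * z) = sol_count p A cs (0 - (c1 + c2) * z mod p)" for z
        by (rule sol_count_cong; simp add: mod_eq_dvd_iff[symmetric])+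
      then show "(\<Sum>z\<in>B. ?r z * sol_count p A cs (0 - (c1 + c2) * z)) =
        (\<Sum>z\<in>B. ((\<lambda>t. sol_count p A [c1, c2] t * sol_count p A cs (0 - t)) \<circ> (\<lambda>z. (c1 + c2) * z mod p)) z)"
        by (simp only: o_def)
    qed
    also have "\<dots> \<le> (\<Sum>t\<in>{0..<p}. sol_count p A [c1, c2] t * sol_count p A cs (0 - t))"
      using p0 by (intro sum_mono2 mult_nonneg_nonneg sol_count_nonneg) auto
    also have "\<dots> = sol_count p A ([c1, c2] @ cs) 0"
      using sol_count_append[OF p0, of A "[c1, c2]" cs 0] by simp
    finally show "\<gamma> * \<gamma>' * real_of_int p ^ (length (c1 # c2 # cs) - 1) \<le> sol_count p A (c1 # c2 # cs) 0"
      by (simp add: mult_ac del: sol_count.simps)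
  qed
qed

text \<open>These two exchanges generate all orders of the first three coefficients, so any two of
  them can be brought to the front for merging.\<close>

lemma supersaturated_swap:
  "supersaturated (c # d # cs) = supersaturated (d # c # cs)"
  "supersaturated (b # c # d # cs) = supersaturated (b # d # c # cs)"
  unfolding supersaturated_def sol_count_swap[of _ _ c d]
    sol_count.simps(2)[of _ _ b "c # d # cs"] sol_count.simps(2)[of _ _ b "d # c # cs"]
  by (simp_all only: list.size)

text \<open>Merging two coefficients keeps the total zero and shortens the list; the merged
  coefficient must be nonzero. Among three nonzero coefficients some pair has nonzero sum: if all
  three pairwise sums vanished, so would the coefficients. A nonempty rest \<open>r\<close> keeps
  the merged list at length at least 3.\<close>

theorem supersaturated_zero_sum:
  assumes "length cs \<ge> 3" "0 \<notin> set cs" "sum_list cs = 0"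
  shows "supersaturated cs"
  using assms
proof (induction "length cs" arbitrary: cs rule: less_induct)
  case less
  have merge: "supersaturated (a # b # c # r)"
    if "length (a # b # c # r) = length cs" "r \<noteq> []" "0 \<notin> set (a # b # c # r)"
      "a + b + c + sum_list r = 0" "a + b \<noteq> 0" for a b c r
  proof (rule supersaturated_merge)
    show "supersaturated ((a + b) # c # r)"
      using that by (intro less.hyps) (auto simp: Suc_le_eq simp flip: length_greater_0_conv)
  qed (use that in auto)
  obtain a b c r where cs: "cs = a # b # c # r"
    using less.prems(1) by (auto simp: Suc_le_length_iff numeral_3_eq_3)
  note prems = less.prems[unfolded cs, simplified]
  show ?case
  proof (cases "r = []")
    case True
    then show ?thesis using less.prems by (auto simp: cs intro!: supersaturated_triple)
  next
    case False
    consider "a + b \<noteq> 0" | "a + c \<noteq> 0" | "b + c \<noteq> 0"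
      using prems by fastforce
    then show ?thesis
    proof cases
      case 1
      then show ?thesis using merge[of a b c r] prems False by (simp add: cs)
    next
      case 2
      then have "supersaturated (a # c # b # r)" using merge[of a c b r] prems False by (simp add: cs)
      then show ?thesis by (simp add: cs supersaturated_swap(2)[of a b c])
    next
      case 3
      then have "supersaturated (b # c # a # r)" using merge[of b c a r] prems False by (simp add: cs)
      then have "supersaturated (b # a # c # r)" by (simp add: supersaturated_swap(2)[of b a c])
      then show ?thesis by (simp add: cs supersaturated_swap(1)[of a b])
    qed
  qed
qed

section \<open>Shifts, coverings and degenerate solutions\<close>

declare sol_count.simps [simp del]

text \<open>For p-periodic \<open>g\<close> this is even and subadditive in \<open>s\<close>; the
  shifts with small variation play the part of a Bohr set.\<close>

definition shift_variation :: "int \<Rightarrow> (int \<Rightarrow> real) \<Rightarrow> int \<Rightarrow> real" where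
  "shift_variation p g s = (\<Sum>t\<in>{0..<p}. \<bar>g (t + s) - g t\<bar>)"

lemma shift_variation_diff:
  assumes "p > 0" and per: "\<And>x y. p dvd x - y \<Longrightarrow> g x = g y"
  shows "(\<Sum>t\<in>{0..<p}. \<bar>g (t + u) - g (t + v)\<bar>) = shift_variation p g (u - v)"
proof -
  let ?f = "\<lambda>t. \<bar>g (t + (u - v)) - g t\<bar>"
  have "?f x = ?f y" if "p dvd x - y" for x y
    using per[of x y] per[of "x + (u - v)" "y + (u - v)"] that by simp
  from sum_periodic_shift[of p ?f, OF assms(1) this, of v]
  show ?thesis by (simp add: shift_variation_def algebra_simps)
qed

lemma shift_variation_cong:
  assumes per: "\<And>x y. p dvd x - y \<Longrightarrow> g x = g y" and "p dvd s - s'"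
  shows "shift_variation p g s = shift_variation p g s'"
  unfolding shift_variation_def using assms(2) per[of "t + s" "t + s'" for t] by simp

lemma shift_variation_minus:
  assumes "p > 0" and per: "\<And>x y. p dvd x - y \<Longrightarrow> g x = g y"
  shows "shift_variation p g (- s) = shift_variation p g s"
proof -
  have "shift_variation p g (0 - s) = (\<Sum>t\<in>{0..<p}. \<bar>g (t + 0) - g (t + s)\<bar>)"
    using shift_variation_diff[of p g 0 s] assms by simp
  then show ?thesis by (simp add: shift_variation_def abs_minus_commute)
qed

lemma shift_variation_add:
  assumes "p > 0" and per: "\<And>x y. p dvd x - y \<Longrightarrow> g x = g y"
  shows "shift_variation p g (r + s) \<le> shift_variation p g r + shift_variation p g s"
proof -
  have "shift_variation p g (r + s) \<le>
      (\<Sum>t\<in>{0..<p}. \<bar>g (t + (r + s)) - g (t + s)\<bar> + \<bar>g (t + s) - g t\<bar>)"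
    unfolding shift_variation_def by (intro sum_mono) linarith
  also have "\<dots> = shift_variation p g (r + s - s) + shift_variation p g s"
    using shift_variation_diff[of p g "r + s" s] assms by (simp add: sum.distrib shift_variation_def)
  finally show ?thesis by simp
qed

lemma shift_variation_sum:
  fixes \<eta> :: real
  assumes "p > 0" and per: "\<And>x y. p dvd x - y \<Longrightarrow> g x = g y" and "finite J"
    and "\<And>i. i \<in> J \<Longrightarrow> shift_variation p g (s i) \<le> \<eta>"
  shows "shift_variation p g (\<Sum>i\<in>J. s i) \<le> card J * \<eta>"
  using assms(3,4)
proof (induction J rule: finite_induct)
  case empty
  then show ?case by (simp add: shift_variation_def)
next
  case (insert i J)
  have "shift_variation p g (s i + (\<Sum>i\<in>J. s i)) \<le> \<eta> + card J * \<eta>"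
    using shift_variation_add[of p g "s i" "\<Sum>i\<in>J. s i"] assms(1) per insert by fastforce
  then show ?case using insert by (simp add: algebra_simps)
qed

text \<open>Because c1 has an inverse b modulo p, translating the target by u amounts to translating
  the first variable by b u. All translates are thus images of Boolean functions under one kernel,
  bounded by 1 since c2 is invertible. The radius \<eta>/2 of the packing becomes \<eta> for two
  points of one colour.\<close>

lemma pair_count_covering:
  fixes \<eta> :: real
  assumes "\<eta> > 0"
  obtains W :: nat where "\<And>p A c1 c2. prime p \<Longrightarrow> A \<subseteq> {0..<p} \<Longrightarrow> \<not> p dvd c1 \<Longrightarrow> \<not> p dvd c2 \<Longrightarrow>
    \<exists>col :: int \<Rightarrow> nat. (\<forall>u\<in>{0..<p}. col u < W) \<and> (\<forall>u\<in>{0..<p}. \<forall>v\<in>{0..<p}. col u = col v \<longrightarrow>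
      shift_variation p (sol_count p A [c1, c2]) (u - v) \<le> \<eta> * (real_of_int p)\<^sup>2)"
proof -
  obtain k :: nat where k: "(8 / \<eta>)\<^sup>2 < k" using reals_Archimedean2 by blast
  then have k0: "k > 0" using le_less_trans[OF zero_le_power2] by (metis of_nat_0_less_iff)
  have "8 / \<eta> \<le> sqrt k" using k by (intro real_le_rsqrt) simp
  then have k4: "4 / sqrt k \<le> \<eta> / 2"
    using k0 \<open>\<eta> > 0\<close> by (simp add: field_simps)
  show ?thesis
  proof (rule that[of "2 * 2 ^ k + 1"])
    fix p :: int and A c1 c2 assume p: "prime p" and A: "A \<subseteq> {0..<p}" and c: "\<not> p dvd c1" "\<not> p dvd c2"
    have p0: "p > 0" using prime_gt_0_int[OF p] .
    let ?g = "sol_count p A [c1, c2]"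
    let ?d = "\<lambda>u v. \<Sum>t\<in>{0..<p}. \<bar>?g (t + u) - ?g (t + v)\<bar>"
    have "coprime p c1" using p c by (intro prime_imp_coprime)
    then obtain a b where "a * p + b * c1 = 1" using bezout_int[of p c1] by auto
    then have inv: "p dvd u - c1 * (b * u)" for u
    proof -
      assume *: "a * p + b * c1 = 1"
      have "u - c1 * (b * u) = u * (1 - b * c1)" by (simp add: algebra_simps)
      also have "1 - b * c1 = a * p" using * by simp
      finally show ?thesis by simp
    qed
    define h where "h = (\<lambda>u x. (x + b * u) mod p \<in> A)"
    define K where "K = (\<lambda>x t. sol_count p A [c2] (t - c1 * x))"
    have K: "\<bar>K x t\<bar> \<le> 1" for x t
      using sol_count_le[OF p A, of "[c2]" "t - c1 * x"] sol_count_nonneg[of p A "[c2]" "t - c1 * x"] c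
      by (simp add: K_def)
    have g: "(\<Sum>x\<in>{0..<p}. of_bool (h u x) * K x t) = ?g (t + u)" for u t
    proof -
      let ?f = "\<lambda>y. of_bool (y mod p \<in> A) * sol_count p A [c2] (t + u - c1 * y)"
      have "?g (t + u) = (\<Sum>y\<in>A. sol_count p A [c2] (t + u - c1 * y))"
        by (simp only: sol_count.simps(2)[of p A c1])
      also have "\<dots> = (\<Sum>y\<in>{0..<p}. ?f y)"
        using A by (intro sum.mono_neutral_cong_left) auto
      also have "\<dots> = (\<Sum>x\<in>{0..<p}. ?f (x + b * u))"
      proof (rule sum_periodic_shift[OF p0, symmetric])
        fix x y assume xy: "p dvd x - y"
        then have "p dvd c1 * (y - x)" by (metis dvd_minus_iff dvd_mult minus_diff_eq)
        then have "p dvd (t + u - c1 * x) - (t + u - c1 * y)" by (simp add: algebra_simps)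
        then have "sol_count p A [c2] (t + u - c1 * x) = sol_count p A [c2] (t + u - c1 * y)"
          by (rule sol_count_cong)
        moreover have "x mod p = y mod p" using xy by (simp add: mod_eq_dvd_iff)
        ultimately show "?f x = ?f y" by simp
      qed
      also have "\<dots> = (\<Sum>x\<in>{0..<p}. of_bool (h u x) * K x t)"
      proof (rule sum.cong[OF refl])
        fix x
        have "p dvd (t + u - c1 * (x + b * u)) - (t - c1 * x)" using inv[of u] by (simp add: algebra_simps)
        then have "sol_count p A [c2] (t + u - c1 * (x + b * u)) = K x t"
          unfolding K_def by (rule sol_count_cong)
        then show "?f (x + b * u) = of_bool (h u x) * K x t" by (simp only: h_def)
      qed
      finally show ?thesis by simp
    qed
    have packing: "\<exists>u\<in>S. \<exists>v\<in>S. u \<noteq> v \<and> ?d u v \<le> \<eta> / 2 * (real_of_int p)\<^sup>2"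
      if S: "S \<subseteq> {0..<p}" "card S \<ge> 2 * 2 ^ k + 1" for S
    proof -
      have "card S > 2 * 2 ^ k" using S by simp
      then obtain u v where uv: "u \<in> S" "v \<in> S" "u \<noteq> v"
        and "(\<Sum>z\<in>{0..<p}. \<bar>(\<Sum>x\<in>{0..<p}. of_bool (h u x) * K x z) - (\<Sum>x\<in>{0..<p}. of_bool (h v x) * K x z)\<bar>)
          \<le> 4 / sqrt k * card {0..<p} * card {0..<p}"
        using kernel_images_close[of "{0..<p}" "{0..<p}" k S K h] p0 k0 K by auto
      then have "?d u v \<le> 4 / sqrt k * (real_of_int p)\<^sup>2"
        unfolding g using p0 by (simp add: power2_eq_square mult.assoc)
      also have "\<dots> \<le> \<eta> / 2 * (real_of_int p)\<^sup>2" using k4 by (intro mult_right_mono) auto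
      finally show ?thesis using uv by blast
    qed
    have triangle: "?d u w \<le> ?d u v + ?d v w" for u v w
      unfolding sum.distrib[symmetric] by (intro sum_mono) linarith
    have sym: "?d u v = ?d v u" for u v by (intro sum.cong refl abs_minus_commute)
    have refl: "?d u u \<le> \<eta> / 2 * (real_of_int p)\<^sup>2" for u using assms by simp
    have var: "shift_variation p ?g (u - v) = ?d u v" for u v
      by (rule shift_variation_diff[OF p0 sol_count_cong, symmetric])
    show "\<exists>col :: int \<Rightarrow> nat. (\<forall>u\<in>{0..<p}. col u < 2 * 2 ^ k + 1) \<and>
      (\<forall>u\<in>{0..<p}. \<forall>v\<in>{0..<p}. col u = col v \<longrightarrow> shift_variation p ?g (u - v) \<le> \<eta> * (real_of_int p)\<^sup>2)"
    proof (rule packing_imp_covering[OF finite_atLeastLessThan_int packing sym refl triangle])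
      fix col :: "int \<Rightarrow> nat"
      assume "\<And>u. u \<in> {0..<p} \<Longrightarrow> col u < 2 * 2 ^ k + 1"
        and "\<And>u v. u \<in> {0..<p} \<Longrightarrow> v \<in> {0..<p} \<Longrightarrow> col u = col v \<Longrightarrow> ?d u v \<le> 2 * (\<eta> / 2 * (real_of_int p)\<^sup>2)"
      then show ?thesis
        unfolding var by (intro exI[of _ col] conjI ballI impI) simp_all
    qed
  qed
qed

text \<open>In the convolution of the pair count with the count for \<open>cs\<close>, only the
  first factor is shifted. Its L1 change is multiplied by the maximum of the second factor; that
  maximum is p^(length cs - 1) only because \<open>cs\<close> is nonempty.\<close>

lemma sol_count_shift_ge:
  assumes p: "prime p" and A: "A \<subseteq> {0..<p}" and cs: "cs \<noteq> []" "\<And>c. c \<in> set cs \<Longrightarrow> \<not> p dvd c"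
  shows "sol_count p A (c1 # c2 # cs) s \<ge> sol_count p A (c1 # c2 # cs) 0 -
    shift_variation p (sol_count p A [c1, c2]) s * real_of_int p ^ (length cs - 1)"
proof -
  let ?g = "sol_count p A [c1, c2]" and ?r = "sol_count p A cs"
  have p0: "p > 0" using prime_gt_0_int[OF p] .
  let ?f = "\<lambda>t. ?g t * ?r (s - t)"
  have per: "?f x = ?f y" if "p dvd x - y" for x y
  proof -
    have "p dvd (s - x) - (s - y)" using that by (simp add: dvd_diff_commute)
    then show ?thesis using that sol_count_cong by metis
  qed
  have "sol_count p A (c1 # c2 # cs) s = (\<Sum>t\<in>{0..<p}. ?f t)"
    using sol_count_append[OF p0, of A "[c1, c2]" cs s] by simp
  also have "\<dots> = (\<Sum>t\<in>{0..<p}. ?f (t + s))"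
    by (rule sum_periodic_shift[OF p0 per, symmetric])
  finally have s: "sol_count p A (c1 # c2 # cs) s = (\<Sum>t\<in>{0..<p}. ?g (t + s) * ?r (0 - t))"
    by (simp)
  have "sol_count p A (c1 # c2 # cs) 0 = (\<Sum>t\<in>{0..<p}. ?g t * ?r (0 - t))"
    using sol_count_append[OF p0, of A "[c1, c2]" cs 0] by simp
  then have "sol_count p A (c1 # c2 # cs) 0 - sol_count p A (c1 # c2 # cs) s =
      (\<Sum>t\<in>{0..<p}. (?g t - ?g (t + s)) * ?r (0 - t))"
    unfolding s by (simp only: sum_subtractf left_diff_distrib)
  also have "\<dots> \<le> (\<Sum>t\<in>{0..<p}. \<bar>?g (t + s) - ?g t\<bar> * real_of_int p ^ (length cs - 1))"
  proof (intro sum_mono mult_mono)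
    show "?r (0 - t) \<le> real_of_int p ^ (length cs - 1)" for t
      by (rule sol_count_le[OF p A cs])
  qed (simp_all add: sol_count_nonneg)
  also have "\<dots> = shift_variation p ?g s * real_of_int p ^ (length cs - 1)"
    by (simp only: shift_variation_def sum_distrib_right)
  finally show ?thesis by linarith
qed

lemma sum_list_zip_nth:
  fixes cs xs :: "int list"
  assumes "length xs = length cs"
  shows "(\<Sum>(c, x)\<leftarrow>zip cs xs. c * x) = (\<Sum>n<length cs. cs ! n * xs ! n)"
  using assms by (simp add: sum_list_sum_nth atLeast0LessThan)

text \<open>The coordinates other than \<open>i\<close> and \<open>l\<close> determine coordinate
  \<open>i\<close> by \<open>det\<close>, and then coordinate \<open>l\<close> by the equation, its
  coefficient being invertible.\<close>

lemma card_constrained_solutions: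
  assumes p: "prime p" and A: "A \<subseteq> {0..<p}" and cs: "\<And>c. c \<in> set cs \<Longrightarrow> \<not> p dvd c"
    and il: "i < length cs" "l < length cs" "i \<noteq> l" and Y: "Y \<subseteq> solutions p A cs s"
    and det: "\<And>xs ys. xs \<in> Y \<Longrightarrow> ys \<in> Y \<Longrightarrow>
      (\<And>n. n < length cs \<Longrightarrow> n \<noteq> i \<Longrightarrow> n \<noteq> l \<Longrightarrow> xs ! n = ys ! n) \<Longrightarrow> xs ! i = ys ! i"
  shows "card Y \<le> nat p ^ (length cs - 2)"
proof -
  let ?N = "{..<length cs} - {i, l}"
  let ?h = "\<lambda>xs. restrict ((!) xs) ?N"
  have nth_range: "xs ! n \<in> {0..<p}" if "xs \<in> Y" "n < length cs" for xs n
  proof -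
    have "set xs \<subseteq> A" "length xs = length cs" using that(1) Y by (auto simp: solutions_def)
    moreover from this have "xs ! n \<in> set xs" using that(2) by simp
    ultimately show ?thesis using A by blast
  qed
  have "inj_on ?h Y"
  proof (rule inj_onI)
    fix xs ys assume xy: "xs \<in> Y" "ys \<in> Y" and eq: "?h xs = ?h ys"
    have off: "xs ! n = ys ! n" if "n < length cs" "n \<noteq> i" "n \<noteq> l" for n
      using fun_cong[OF eq, of n] that by simp
    have ei: "xs ! i = ys ! i" using det xy off by blast
    have len: "length xs = length cs" "length ys = length cs"
      using xy Y by (auto simp: solutions_def)
    have "p dvd s - (\<Sum>n<length cs. cs ! n * xs ! n)" "p dvd s - (\<Sum>n<length cs. cs ! n * ys ! n)"
      using xy Y len by (auto simp: solutions_def sum_list_zip_nth)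
    then have "p dvd (s - (\<Sum>n<length cs. cs ! n * ys ! n)) - (s - (\<Sum>n<length cs. cs ! n * xs ! n))"
      by (blast intro: dvd_diff)
    also have "\<dots> = (\<Sum>n<length cs. cs ! n * xs ! n - cs ! n * ys ! n)"
      by (simp add: sum_subtractf)
    also have "\<dots> = (\<Sum>n\<in>{l}. cs ! n * xs ! n - cs ! n * ys ! n)"
      using off ei il by (intro sum.mono_neutral_right) force+
    finally have "p dvd cs ! l * xs ! l - cs ! l * ys ! l" by simp
    moreover have "xs ! l \<in> {0..<p}" "ys ! l \<in> {0..<p}"
      using nth_range xy il by blast+
    ultimately have "xs ! l = ys ! l"
      using cs il by (intro mult_mod_eq_imp_eq[OF p, of "cs ! l"]) auto
    with off ei show "xs = ys" using len by (intro nth_equalityI) metis+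
  qed
  moreover have "?h ` Y \<subseteq> (\<Pi>\<^sub>E n\<in>?N. {0..<p})"
  proof (intro image_subsetI)
    fix xs assume xs: "xs \<in> Y"
    show "?h xs \<in> (\<Pi>\<^sub>E n\<in>?N. {0..<p})" using nth_range[OF xs] by (simp add: PiE_iff)
  qed
  ultimately have "card Y \<le> card (\<Pi>\<^sub>E n\<in>?N. {0..<p})"
    by (intro card_inj_on_le[of ?h] finite_PiE) auto
  also have "\<dots> = nat p ^ card ?N" by (simp add: card_PiE)
  also have "card ?N = length cs - 2" using il by (simp add: card_Diff_subset)
  finally show ?thesis .
qed

text \<open>Union bound: each coincidence of two slots, and each slot with a prescribed value in
  \<open>E\<close>, removes one dimension in addition to the equation.\<close>

lemma card_degenerate_solutions:
  assumes p: "prime p" and A: "A \<subseteq> {0..<p}" and cs: "\<And>c. c \<in> set cs \<Longrightarrow> \<not> p dvd c"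
    and len: "length cs \<ge> 3" and E: "finite E"
  shows "card {xs \<in> solutions p A cs s. \<not> distinct xs \<or> set xs \<inter> E \<noteq> {}}
    \<le> (length cs * length cs + length cs * card E) * nat p ^ (length cs - 2)"
proof -
  let ?m = "length cs"
  let ?S = "solutions p A cs s"
  have finA: "finite A" using A finite_subset by blast
  have fin: "finite ?S" by (rule finite_solutions[OF finA])
  define T where "T = {(i, j). i < ?m \<and> j < ?m \<and> i \<noteq> j}"
  have T: "T \<subseteq> {..<?m} \<times> {..<?m}" by (auto simp: T_def)
  then have finT: "finite T" by (rule finite_subset) simp
  have "card T \<le> card ({..<?m} \<times> {..<?m})" by (rule card_mono[OF _ T]) simp
  then have cardT: "card T \<le> ?m * ?m" by simp
  define D1 where "D1 = (\<lambda>(i, j). {xs \<in> ?S. xs ! i = xs ! j})"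
  define D2 where "D2 = (\<lambda>(i, e). {xs \<in> ?S. xs ! i = e})"
  have D1: "card (D1 t) \<le> nat p ^ (?m - 2)" if "t \<in> T" for t
  proof -
    from that obtain i j where t: "t = (i, j)" "i < ?m" "j < ?m" "i \<noteq> j" by (auto simp: T_def)
    \<comment> \<open>A third index \<open>l\<close> is what makes the equation cut down the dimension once more, even if
      \<open>cs ! i + cs ! j = 0\<close>.\<close>
    have "\<not> {..<?m} \<subseteq> {i, j}"
      using len card_mono[of "{i, j}" "{..<?m}"] t by auto
    then obtain l where l: "l < ?m" "l \<noteq> i" "l \<noteq> j" by auto
    show ?thesis
    proof (rule card_constrained_solutions[OF p A cs t(2) l(1)])
      show "D1 t \<subseteq> ?S" by (auto simp: D1_def t)
      fix xs ys assume "xs \<in> D1 t" "ys \<in> D1 t"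
        "\<And>n. n < ?m \<Longrightarrow> n \<noteq> i \<Longrightarrow> n \<noteq> l \<Longrightarrow> xs ! n = ys ! n"
      then show "xs ! i = ys ! i" using t l by (simp add: D1_def)
    qed (use l in auto)
  qed
  have D2: "card (D2 t) \<le> nat p ^ (?m - 2)" if "t \<in> {..<?m} \<times> E" for t
  proof -
    from that obtain i e where t: "t = (i, e)" "i < ?m" by auto
    have "\<not> {..<?m} \<subseteq> {i}" using len card_mono[of "{i}" "{..<?m}"] by auto
    then obtain l where l: "l < ?m" "l \<noteq> i" by auto
    show ?thesis
      by (rule card_constrained_solutions[OF p A cs t(2) l(1)]) (use l in \<open>auto simp: D2_def t\<close>)
  qed
  have "{xs \<in> ?S. \<not> distinct xs \<or> set xs \<inter> E \<noteq> {}} \<subseteq> (\<Union>t\<in>T. D1 t) \<union> (\<Union>t\<in>{..<?m} \<times> E. D2 t)"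
  proof
    fix xs assume xs: "xs \<in> {xs \<in> ?S. \<not> distinct xs \<or> set xs \<inter> E \<noteq> {}}"
    then have l: "length xs = ?m" by (simp add: solutions_def)
    show "xs \<in> (\<Union>t\<in>T. D1 t) \<union> (\<Union>t\<in>{..<?m} \<times> E. D2 t)"
    proof (cases "distinct xs")
      case False
      then obtain i j where "i < ?m" "j < ?m" "i \<noteq> j" "xs ! i = xs ! j"
        unfolding distinct_conv_nth l by blast
      then have "(i, j) \<in> T" "xs \<in> D1 (i, j)" using xs by (auto simp: T_def D1_def)
      then show ?thesis by blast
    next
      case True
      then obtain e where "e \<in> E" "e \<in> set xs" using xs by auto
      then obtain i where "i < ?m" "xs ! i = e" by (metis in_set_conv_nth l)
      then have "(i, e) \<in> {..<?m} \<times> E" "xs \<in> D2 (i, e)" using xs \<open>e \<in> E\<close> by (auto simp: D2_def)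
      then show ?thesis by blast
    qed
  qed
  moreover have "finite ((\<Union>t\<in>T. D1 t) \<union> (\<Union>t\<in>{..<?m} \<times> E. D2 t))"
    using fin E finT by (auto simp: D1_def D2_def split: prod.splits)
  ultimately have "card {xs \<in> ?S. \<not> distinct xs \<or> set xs \<inter> E \<noteq> {}} \<le>
      card ((\<Union>t\<in>T. D1 t) \<union> (\<Union>t\<in>{..<?m} \<times> E. D2 t))"
    by (intro card_mono)
  also have "\<dots> \<le> card (\<Union>t\<in>T. D1 t) + card (\<Union>t\<in>{..<?m} \<times> E. D2 t)" by (rule card_Un_le)
  also have "\<dots> \<le> (\<Sum>t\<in>T. card (D1 t)) + (\<Sum>t\<in>{..<?m} \<times> E. card (D2 t))"
    using E finT by (intro add_mono card_UN_le) auto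
  also have "\<dots> \<le> (\<Sum>t\<in>T. nat p ^ (?m - 2)) + (\<Sum>t\<in>{..<?m} \<times> E. nat p ^ (?m - 2))"
    by (intro add_mono sum_mono D1 D2)
  also have "\<dots> = (card T + ?m * card E) * nat p ^ (?m - 2)"
    by (simp add: card_cartesian_product distrib_right)
  also have "\<dots> \<le> (?m * ?m + ?m * card E) * nat p ^ (?m - 2)"
    using cardT by (intro mult_right_mono add_mono) auto
  finally show ?thesis .
qed

text \<open>The values \<open>e\<close> outside \<open>I\<close> become the target of the equation
  on \<open>I\<close>; \<open>map_of\<close> puts the entries of \<open>xs\<close> back into the
  slots listed by \<open>is\<close>.\<close>

lemma not_solution_free_extend:
  assumes I: "set is = I" "distinct is" "I \<subseteq> {0..<k}"
    and xs: "xs \<in> solutions p A (map c is) (- (\<Sum>i\<in>{0..<k} - I. c i * e i))" "distinct xs"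
    and e: "e ` ({0..<k} - I) \<subseteq> A" "inj_on e ({0..<k} - I)" "set xs \<inter> e ` ({0..<k} - I) = {}"
  shows "\<not> solution_free k c p A"
proof -
  define J where "J = {0..<k} - I"
  note e = e[folded J_def]
  have len: "length xs = length is" and xsA: "set xs \<subseteq> A" using xs by (auto simp: solutions_def)
  define x where "x = (\<lambda>i. if i \<in> J then e i else the (map_of (zip is xs) i))"
  have x_nth: "x (is ! n) = xs ! n" if "n < length is" for n
  proof -
    have "is ! n \<notin> J" using that I by (auto simp: J_def)
    then show ?thesis using that I len by (simp add: x_def map_of_zip_nth)
  qed
  have x_J: "x i = e i" if "i \<in> J" for i using that by (simp add: x_def)
  have I_nth: "\<exists>n<length is. i = is ! n" if "i \<in> I" for i
    using that I(1) by (metis in_set_conv_nth)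
  have x_I: "x i \<in> set xs" if "i \<in> I" for i
    using I_nth[OF that] x_nth len by auto
  have inj_I: "inj_on x I"
  proof (rule inj_onI)
    fix i j assume "i \<in> I" "j \<in> I" "x i = x j"
    moreover obtain n m where "n < length is" "i = is ! n" "m < length is" "j = is ! m"
      using I_nth calculation by metis
    ultimately show "i = j" using x_nth xs(2) len by (metis nth_eq_iff_index_eq)
  qed
  have split: "{0..<k} = I \<union> J" "I \<inter> J = {}" "finite I" "finite J"
    using I by (auto simp: J_def)
  have "inj_on x ({0..<k})"
  proof -
    have "inj_on x J" using e(2) x_J by (simp add: inj_on_def)
    moreover have "x ` I \<inter> x ` J = {}" using x_I x_J e(3) by fastforce
    ultimately show ?thesis unfolding split(1) inj_on_Un using inj_I by blast
  qed
  moreover have "\<forall>i<k. x i \<in> A"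
  proof (intro allI impI)
    fix i assume "i < k"
    then have "i \<in> I \<union> J" using split(1) by auto
    then show "x i \<in> A" using x_I x_J xsA e(1) by auto
  qed
  moreover have "(\<Sum>i<k. c i * x i) mod p = 0"
  proof -
    have "(\<Sum>i<k. c i * x i) = (\<Sum>i\<in>I. c i * x i) + (\<Sum>i\<in>J. c i * x i)"
      using split by (simp add: sum.union_disjoint flip: atLeast0LessThan)
    also have "(\<Sum>i\<in>J. c i * x i) = (\<Sum>i\<in>J. c i * e i)" using x_J by simp
    also have "(\<Sum>i\<in>I. c i * x i) = (\<Sum>i\<leftarrow>is. c i * x i)"
      using I by (simp add: sum_list_distinct_conv_sum_set)
    also have "\<dots> = (\<Sum>n<length is. c (is ! n) * x (is ! n))"
      by (simp add: sum_list_sum_nth atLeast0LessThan)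
    also have "\<dots> = (\<Sum>(c, x)\<leftarrow>zip (map c is) xs. c * x)"
      using len x_nth by (simp add: sum_list_zip_nth)
    finally have "- (\<Sum>i\<in>J. c i * e i) - (\<Sum>(c, x)\<leftarrow>zip (map c is) xs. c * x) = - (\<Sum>i<k. c i * x i)"
      by simp
    moreover have "p dvd - (\<Sum>i\<in>J. c i * e i) - (\<Sum>(c, x)\<leftarrow>zip (map c is) xs. c * x)"
      using xs(1) by (simp add: solutions_def J_def)
    ultimately show ?thesis by (metis dvd_minus_iff dvd_imp_mod_0)
  qed
  ultimately show ?thesis unfolding solution_free_def not_not by (intro exI[of _ x] conjI)
qed

section \<open>Bounded chromatic number\<close>

text \<open>Elements of \<open>E\<close> fill the slots outside \<open>I\<close>. Their combined
  shift has variation at most k * \<gamma> p^2 / (2 k), so at least half of the solutions counted at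
  target 0 persist at the new target. By \<open>large\<close> these outnumber the solutions that
  repeat an entry or meet \<open>E\<close>.\<close>

lemma large_structured_part_imp_solution:
  fixes k :: nat and c :: "nat \<Rightarrow> int" and p :: int and \<gamma> :: real
  assumes p: "prime p" and A: "A \<subseteq> {0..<p}" and cp: "\<And>i. i < k \<Longrightarrow> \<not> p dvd c i"
    and I: "set is = I" "distinct is" "I \<subseteq> {0..<k}" and cs: "map c is = c1 # c2 # cs" "cs \<noteq> []"
    and count: "sol_count p A (map c is) 0 \<ge> \<gamma> * real_of_int p ^ (length is - 1)"
    and large: "\<gamma> * p > 2 * (length is * length is + length is * k)"
    and E: "E \<subseteq> A" "card E = card ({0..<k} - I)" "finite E"
      "\<And>d i. d \<in> E \<Longrightarrow> i \<in> {0..<k} - I \<Longrightarrow>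
        2 * k * shift_variation p (sol_count p A [c1, c2]) (c i * d) \<le> \<gamma> * (real_of_int p)\<^sup>2"
  shows "\<not> solution_free k c p A"
proof -
  let ?J = "{0..<k} - I" and ?m = "length is"
  let ?g = "sol_count p A [c1, c2]"
  have p0: "p > 0" using prime_gt_0_int[OF p] .
  have finA: "finite A" using A finite_subset by blast
  have m: "?m = length cs + 2" using arg_cong[OF cs(1), of length] by simp
  have cs_len: "length cs \<ge> 1" using cs(2) by (simp add: Suc_le_eq)
  have csp: "\<not> p dvd x" if "x \<in> set (map c is)" for x using that I cp by auto
  obtain e where e: "bij_betw e ?J E"
    using finite_same_card_bij[of ?J E] E by auto
  define s where "s = - (\<Sum>i\<in>?J. c i * e i)"
  have \<gamma>: "\<gamma> * (real_of_int p)\<^sup>2 \<ge> 0"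
  proof -
    have "\<gamma> * p > 0" using large by (rule le_less_trans[rotated]) simp
    then show ?thesis using p0 by (simp add: power2_eq_square zero_less_mult_iff)
  qed
  have "shift_variation p ?g (\<Sum>i\<in>?J. c i * e i) \<le> card ?J * (\<gamma> * (real_of_int p)\<^sup>2 / (2 * k))"
  proof (rule shift_variation_sum[OF p0])
    show "?g x = ?g y" if "p dvd x - y" for x y using that by (rule sol_count_cong)
    fix i assume i: "i \<in> ?J"
    then have "e i \<in> E" using e by (auto simp: bij_betw_def)
    from E(4)[OF this i] show "shift_variation p ?g (c i * e i) \<le> \<gamma> * (real_of_int p)\<^sup>2 / (2 * k)"
      using i by (simp add: field_simps)
  qed auto
  also have "\<dots> \<le> k * (\<gamma> * (real_of_int p)\<^sup>2 / (2 * k))"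
  proof (rule mult_right_mono)
    have "card ?J \<le> k" using card_mono[of "{0..<k}" ?J] by simp
    then show "real (card ?J) \<le> real k" by simp
  qed (use \<gamma> in simp)
  also have "\<dots> \<le> \<gamma> * (real_of_int p)\<^sup>2 / 2" using \<gamma> by simp
  finally have var: "shift_variation p ?g s \<le> \<gamma> * (real_of_int p)\<^sup>2 / 2"
    using shift_variation_minus[of p ?g, OF p0 sol_count_cong] by (simp add: s_def)
  have pow: "(real_of_int p)\<^sup>2 * real_of_int p ^ (length cs - 1) = real_of_int p ^ (?m - 1)"
    using cs(2) by (cases cs) (simp_all add: m power2_eq_square)
  have "shift_variation p ?g s * real_of_int p ^ (length cs - 1) \<le>
      \<gamma> * (real_of_int p)\<^sup>2 / 2 * real_of_int p ^ (length cs - 1)"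
    using var p0 by (intro mult_right_mono) auto
  also have "\<dots> = \<gamma> / 2 * real_of_int p ^ (?m - 1)"
    unfolding pow[symmetric] by simp
  finally have "shift_variation p ?g s * real_of_int p ^ (length cs - 1) \<le> \<gamma> / 2 * real_of_int p ^ (?m - 1)" .
  moreover have "sol_count p A (map c is) s \<ge> sol_count p A (map c is) 0 -
      shift_variation p ?g s * real_of_int p ^ (length cs - 1)"
    unfolding cs(1) using csp unfolding cs(1) by (intro sol_count_shift_ge[OF p A cs(2)]) auto
  ultimately have lower: "sol_count p A (map c is) s \<ge> \<gamma> / 2 * real_of_int p ^ (?m - 1)"
    using count by linarith
  define bad where "bad = {xs \<in> solutions p A (map c is) s. \<not> distinct xs \<or> set xs \<inter> E \<noteq> {}}"
  have "card bad \<le> (?m * ?m + ?m * card E) * nat p ^ (?m - 2)"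
    using card_degenerate_solutions[of p A "map c is" E s, OF p A csp _ E(3)] cs_len m by (simp add: bad_def)
  also have "\<dots> \<le> (?m * ?m + ?m * k) * nat p ^ (?m - 2)"
    unfolding E(2) using card_mono[of "{0..<k}" ?J] by (intro mult_right_mono add_mono mult_left_mono) auto
  finally have "real (card bad) \<le> real ((?m * ?m + ?m * k) * nat p ^ (?m - 2))"
    by (rule of_nat_mono)
  also have "\<dots> = (?m * ?m + ?m * k) * real_of_int p ^ (?m - 2)" using p0 by simp
  also have "\<dots> < \<gamma> / 2 * p * real_of_int p ^ (?m - 2)"
    using large p0 by (intro mult_strict_right_mono) auto
  also have "\<dots> = \<gamma> / 2 * real_of_int p ^ (?m - 1)"
    by (simp add: m mult.assoc flip: power_Suc)
  also have "\<dots> \<le> card (solutions p A (map c is) s)"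
    using lower finA by (simp add: sol_count_eq_card)
  finally have "card bad < card (solutions p A (map c is) s)" by simp
  then have "\<not> solutions p A (map c is) s \<subseteq> bad"
    using card_mono[of bad "solutions p A (map c is) s"] finite_solutions[OF finA]
    by (auto simp: bad_def not_le)
  then obtain xs where xs: "xs \<in> solutions p A (map c is) s" "distinct xs" "set xs \<inter> E = {}"
    by (auto simp: bad_def)
  have eE: "e ` ?J = E" "inj_on e ?J" using e by (auto simp: bij_betw_def)
  show ?thesis
    using not_solution_free_extend[OF I, of xs p A c e] xs E(1) eE unfolding s_def by simp
qed

theorem theorem3p1:
  fixes k :: nat and c :: "nat \<Rightarrow> int"
  assumes "k \<ge> 3"
    and "\<forall>i<k. c i \<noteq> 0"
    and "\<exists>I \<subseteq> {0..<k}. card I \<ge> 3 \<and> (\<Sum>i\<in>I. c i) = 0"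
  shows "\<forall>\<epsilon>::real. \<epsilon> > 0 \<longrightarrow> (\<exists>C::nat. \<forall>p::int. \<forall>A. prime p \<longrightarrow> A \<subseteq> {0..<p} \<longrightarrow>
            solution_free k c p A \<longrightarrow> real (card A) \<ge> \<epsilon> * real_of_int p \<longrightarrow>
            cay_colourable p A C)"
proof (intro allI impI)
  fix \<epsilon> :: real assume \<epsilon>: "\<epsilon> > 0"
  obtain I where I: "I \<subseteq> {0..<k}" "card I \<ge> 3" "(\<Sum>i\<in>I. c i) = 0" using assms(3) by blast
  have finI: "finite I" using I(1) finite_subset by blast
  define J where "J = {0..<k} - I"
  define xs where "xs = sorted_list_of_set I"
  have xs: "set xs = I" "distinct xs" "length xs = card I" using finI by (auto simp: xs_def)
  obtain c1 c2 cs where cs: "map c xs = c1 # c2 # cs" "cs \<noteq> []"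
  proof -
    have "length (map c xs) \<ge> 3" using xs I by simp
    then obtain a b d r where "map c xs = a # b # d # r"
      by (auto simp: Suc_le_length_iff numeral_3_eq_3 simp del: length_map)
    then show ?thesis using that[of a b "d # r"] by simp
  qed
  have "supersaturated (map c xs)"
  proof (rule supersaturated_zero_sum)
    show "sum_list (map c xs) = 0" using xs I by (simp add: sum_list_distinct_conv_sum_set)
    show "0 \<notin> set (map c xs)" using assms(2) I xs by force
  qed (use xs I in simp)
  then obtain \<gamma> P where \<gamma>: "\<gamma> > 0" and count: "\<And>p A. prime p \<Longrightarrow> p > P \<Longrightarrow> A \<subseteq> {0..<p} \<Longrightarrow>
      real (card A) \<ge> \<epsilon> * real_of_int p \<Longrightarrow>
      sol_count p A (map c xs) 0 \<ge> \<gamma> * real_of_int p ^ (length (map c xs) - 1)"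
    using \<epsilon> by (rule supersaturatedE) blast
  \<comment> \<open>At most \<open>k\<close> slots lie outside \<open>I\<close>, so their shifts
    together cost at most k * \<eta> = \<gamma>/2, half of the guaranteed count.\<close>
  define \<eta> where "\<eta> = \<gamma> / (2 * k)"
  have "\<eta> > 0" using \<gamma> assms(1) by (simp add: \<eta>_def)
  then obtain W :: nat where W: "\<And>p A c1 c2. prime p \<Longrightarrow> A \<subseteq> {0..<p} \<Longrightarrow> \<not> p dvd c1 \<Longrightarrow> \<not> p dvd c2 \<Longrightarrow>
    \<exists>col :: int \<Rightarrow> nat. (\<forall>u\<in>{0..<p}. col u < W) \<and> (\<forall>u\<in>{0..<p}. \<forall>v\<in>{0..<p}. col u = col v \<longrightarrow>
      shift_variation p (sol_count p A [c1, c2]) (u - v) \<le> \<eta> * (real_of_int p)\<^sup>2)"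
    by (rule pair_count_covering) blast
  let ?m = "length xs"
  obtain Q :: nat where Q: "max (max (real_of_int P) (2 * (?m * ?m + ?m * k) / \<gamma>)) (\<Sum>i<k. \<bar>real_of_int (c i)\<bar>) < Q"
    using reals_Archimedean2 by blast
  \<comment> \<open>\<open>Q + 1\<close> serves the primes up to \<open>Q\<close>, whose vertices
    all get different colours. The product counts the vectors of \<open>W\<close> ball colours, one
    for each slot outside \<open>I\<close>, paired with a greedy colour.\<close>
  define C where "C = Q + 1 + W ^ card J * (2 * k + 1)"
  show "\<exists>C::nat. \<forall>p::int. \<forall>A. prime p \<longrightarrow> A \<subseteq> {0..<p} \<longrightarrow>
            solution_free k c p A \<longrightarrow> real (card A) \<ge> \<epsilon> * real_of_int p \<longrightarrow>
            cay_colourable p A C"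
  proof (intro exI[of _ C] allI impI)
    fix p :: int and A
    assume p: "prime p" and A: "A \<subseteq> {0..<p}" and free: "solution_free k c p A"
      and dens: "real (card A) \<ge> \<epsilon> * real_of_int p"
    have p0: "p > 0" using prime_gt_0_int[OF p] .
    have finA: "finite A" using A finite_subset by blast
    show "cay_colourable p A C"
    proof (cases "p \<le> int Q")
      case True
      then show ?thesis
        unfolding cay_colourable_def
        by (intro exI[of _ nat]) (auto simp: C_def cay_adj_def)
    next
      case False
      have big: "p > P" "\<gamma> * p > 2 * (?m * ?m + ?m * k)" "(\<Sum>i<k. \<bar>c i\<bar>) < p"
      proof -
        have pQ: "real Q < p" using False by linarith
        show "p > P" using Q pQ by linarith
        have "2 * (?m * ?m + ?m * k) / \<gamma> < p" using Q pQ by linarith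
        then show "\<gamma> * p > 2 * (?m * ?m + ?m * k)" using \<gamma> by (simp add: field_simps)
        have "real_of_int (\<Sum>i<k. \<bar>c i\<bar>) < p" using Q pQ by simp
        then show "(\<Sum>i<k. \<bar>c i\<bar>) < p" by linarith
      qed
      have cp: "\<not> p dvd c i" if i: "i < k" for i
      proof
        assume "p dvd c i"
        then have "\<bar>p\<bar> \<le> \<bar>c i\<bar>" using assms(2) i by (intro dvd_imp_le_int) auto
        moreover have "\<bar>c i\<bar> \<le> (\<Sum>i<k. \<bar>c i\<bar>)" using i by (intro member_le_sum) auto
        ultimately show False using big(3) p0 by simp
      qed
      let ?g = "sol_count p A [c1, c2]"
      have "c1 \<in> c ` I" "c2 \<in> c ` I" using arg_cong[OF cs(1), of set] xs by auto
      then have "\<not> p dvd c1" "\<not> p dvd c2" using cp I(1) by auto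
      from W[OF p A this] obtain col :: "int \<Rightarrow> nat" where col: "\<And>u. u \<in> {0..<p} \<Longrightarrow> col u < W"
        "\<And>u v. u \<in> {0..<p} \<Longrightarrow> v \<in> {0..<p} \<Longrightarrow> col u = col v \<Longrightarrow>
          shift_variation p ?g (u - v) \<le> \<eta> * (real_of_int p)\<^sup>2"
        by blast
      \<comment> \<open>Every element of \<open>D\<close> suits every slot outside \<open>I\<close>,
        so any \<open>card J\<close> of them may be placed in any order. If \<open>J\<close> is
        empty, so is \<open>E\<close> below, and the argument shows that no solution-free
        \<open>A\<close> of this density exists for such p.\<close>
      define D where "D = {d\<in>A. \<forall>i\<in>J. shift_variation p ?g (c i * d) \<le> \<eta> * (real_of_int p)\<^sup>2}"
      have finD: "finite D" using finA by (simp add: D_def)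
      have "card D < card J"
      proof (rule ccontr)
        assume "\<not> card D < card J"
        then have "card J \<le> card D" by simp
        then obtain E where E: "E \<subseteq> D" "card E = card J" "finite E"
          by (rule obtain_subset_with_card_n)
        have "\<not> solution_free k c p A"
        proof (rule large_structured_part_imp_solution[OF p A cp xs(1,2) I(1) cs _ big(2)])
          show "\<gamma> * real_of_int p ^ (?m - 1) \<le> sol_count p A (map c xs) 0"
            using count[OF p big(1) A dens] by simp
          show "E \<subseteq> A" "card E = card ({0..<k} - I)" "finite E" using E by (auto simp: D_def J_def)
          fix d i assume "d \<in> E" "i \<in> {0..<k} - I"
          then have "shift_variation p ?g (c i * d) \<le> \<eta> * (real_of_int p)\<^sup>2"
            using E(1) by (auto simp: D_def J_def)
          then show "2 * k * shift_variation p ?g (c i * d) \<le> \<gamma> * (real_of_int p)\<^sup>2"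
            using assms(1) by (simp add: \<eta>_def field_simps)
        qed
        then show False using free by simp
      qed
      also have "card J \<le> k" using card_mono[of "{0..<k}" J] by (simp add: J_def)
      finally have cardD: "card D \<le> k" by simp
      define \<Phi> where "\<Phi> = (\<lambda>u. restrict (\<lambda>i. col (c i * u mod p)) J)"
      \<comment> \<open>Adjacency within the classes of \<open>\<Phi>\<close>, taken on the whole
        vertex set, so that one greedy colouring treats all classes at once.\<close>
      define R where "R = (\<lambda>u v. cay_adj p A u v \<and> \<Phi> u = \<Phi> v)"
      have diff_D: "(v - u) mod p \<in> D" if "(v - u) mod p \<in> A" "\<Phi> u = \<Phi> v" for u v
      proof -
        have "shift_variation p ?g (c i * ((v - u) mod p)) \<le> \<eta> * (real_of_int p)\<^sup>2" if i: "i \<in> J" for i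
        proof -
          have "col (c i * v mod p) = col (c i * u mod p)"
            using fun_cong[OF \<open>\<Phi> u = \<Phi> v\<close>, of i] i by (simp add: \<Phi>_def)
          then have "shift_variation p ?g (c i * v mod p - c i * u mod p) \<le> \<eta> * (real_of_int p)\<^sup>2"
            using p0 by (intro col) auto
          moreover have "shift_variation p ?g (c i * ((v - u) mod p)) =
              shift_variation p ?g (c i * v mod p - c i * u mod p)"
          proof (rule shift_variation_cong)
            show "?g x = ?g y" if "p dvd x - y" for x y using that by (rule sol_count_cong)
            show "p dvd c i * ((v - u) mod p) - (c i * v mod p - c i * u mod p)"
              by (simp add: mod_simps right_diff_distrib flip: mod_eq_dvd_iff)
          qed
          ultimately show ?thesis by simp
        qed
        with that show ?thesis by (simp add: D_def)
      qed
      obtain f where f: "\<And>u. f u \<le> 2 * k"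
        "\<And>u v. u \<in> {0..<p} \<Longrightarrow> v \<in> {0..<p} \<Longrightarrow> R u v \<Longrightarrow> f u \<noteq> f v"
      proof (rule greedy_colouring[of "{0..<p}" R "2 * k"])
        show "R v u" if "R u v" for u v using that by (auto simp: R_def cay_adj_def)
        show "\<not> R u u" for u by (simp add: R_def cay_adj_def)
        fix u assume u: "u \<in> {0..<p}"
        \<comment> \<open>The underlying graph forgets the direction of arcs, so each element of
          \<open>D\<close> accounts for up to two neighbours of \<open>u\<close>.\<close>
        have "{v\<in>{0..<p}. R u v} \<subseteq> (\<lambda>d. (u + d) mod p) ` D \<union> (\<lambda>d. (u - d) mod p) ` D"
        proof
          fix v assume "v \<in> {v\<in>{0..<p}. R u v}"
          then have v: "v \<in> {0..<p}" "\<Phi> u = \<Phi> v" "(v - u) mod p \<in> A \<or> (u - v) mod p \<in> A"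
            by (auto simp: R_def cay_adj_def)
          have "(u + (v - u) mod p) mod p = v" "(u - (u - v) mod p) mod p = v"
            using v(1) by (simp_all add: mod_simps)
          with v(3) diff_D[of v u] diff_D[of u v] v(2)
          show "v \<in> (\<lambda>d. (u + d) mod p) ` D \<union> (\<lambda>d. (u - d) mod p) ` D"
            by (metis UnI1 UnI2 imageI)
        qed
        then have "card {v\<in>{0..<p}. R u v} \<le> card ((\<lambda>d. (u + d) mod p) ` D \<union> (\<lambda>d. (u - d) mod p) ` D)"
          using finD by (intro card_mono) auto
        also have "\<dots> \<le> card ((\<lambda>d. (u + d) mod p) ` D) + card ((\<lambda>d. (u - d) mod p) ` D)"
          by (rule card_Un_le)
        also have "\<dots> \<le> card D + card D" using finD by (intro add_mono card_image_le)
        finally show "card {v\<in>{0..<p}. R u v} \<le> 2 * k" using cardD by simp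
      qed auto
      define S where "S = (\<Pi>\<^sub>E i\<in>J. {..<W}) \<times> {..2 * k}"
      have finS: "finite S" by (auto simp: S_def J_def intro: finite_PiE)
      have cardS: "card S = W ^ card J * (2 * k + 1)"
        by (simp add: S_def J_def card_cartesian_product card_PiE)
      obtain h :: "(nat \<Rightarrow> nat) \<times> nat \<Rightarrow> nat" where h: "bij_betw h S {0..<card S}"
        using ex_bij_betw_finite_nat[OF finS] by blast
      have in_S: "(\<Phi> u, f u) \<in> S" for u
        using col(1) f(1) p0 by (auto simp: S_def \<Phi>_def)
      show ?thesis
        unfolding cay_colourable_def
      proof (intro exI[of _ "\<lambda>u. h (\<Phi> u, f u)"] conjI ballI impI)
        fix u
        have "h (\<Phi> u, f u) \<in> {0..<card S}" using h in_S by (auto simp: bij_betw_def)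
        then show "h (\<Phi> u, f u) < C" by (simp add: C_def cardS)
      next
        fix u v assume uv: "u \<in> {0..<p}" "v \<in> {0..<p}" "cay_adj p A u v"
        show "h (\<Phi> u, f u) \<noteq> h (\<Phi> v, f v)"
        proof
          assume "h (\<Phi> u, f u) = h (\<Phi> v, f v)"
          then have "(\<Phi> u, f u) = (\<Phi> v, f v)" using h in_S by (auto simp: bij_betw_def inj_on_def)
          then show False using f(2)[OF uv(1,2)] uv(3) by (simp add: R_def)
        qed
      qed
    qed
  qed
qed

end
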